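(* Let $\sigma$ be an operator mean with representing function $h$. Assume that there exists a probability measure $\nu$ on $[0,1]$ such that $$h(x)=\int_0^1x^\alpha\,d\nu(\alpha),\qquad x\in[0,\infty).$$ Then, for every $A,B\in\mathbb{M}_n^+$ and $k=1,\dots,n$, $$\left\{\prod_{j=n+1-k}^n\mu_j(A\,\sigma\,B)\right\}^{1/k}\ge\left\{\prod_{j=n+1-k}^n\mu_j(A)\right\}^{1/k}\,\sigma\,\left\{\prod_{j=n+1-k}^n\mu_j(B)\right\}^{1/k}.$$
   Context: $\mathbb{M}_n^+$ is the set of positive semidefinite $n\times n$ complex matrices; $\mu_1(X)\ge\dots\ge\mu_n(X)$ are the singular values of $X$ in decreasing order with multiplicities. An operator mean $\sigma$ (in the Kubo–Ando sense) is given by its representing function $h$, a non-negative operator monotone function on $[0,\infty)$ with $h(1)=1$: for invertible $A,B\in\mathbb{M}_n^+$, $A\,\sigma\,B=A^{1/2}h(A^{-1/2}BA^{-1/2})A^{1/2}$, and for general $A,B\in\mathbb{M}_n^+$, $A\,\sigma\,B=\lim_{\varepsilon\searrow0}(A+\varepsilon I)\,\sigma\,(B+\varepsilon I)$. For scalars $a,b\ge0$, $a\,\sigma\,b$ is the case $n=1$ of this definition. Convention: $0^0=1$. *)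

theory Defs
  imports
    "HOL-Probability.Probability_Measure"
    "Jordan_Normal_Form.Schur_Decomposition"
    "Jordan_Normal_Form.Char_Poly"
begin

definition psd :: "nat \<Rightarrow> complex mat \<Rightarrow> bool" where
  "psd n A \<longleftrightarrow> A \<in> carrier_mat n n \<and> mat_adjoint A = A
     \<and> (\<forall>v \<in> carrier_vec n. 0 \<le> (A *\<^sub>v v) \<bullet>c v)"

text \<open>The singular values are the square roots of the eigenvalues of \<open>X\<^sup>* X\<close>, repeated according
  to their multiplicity as roots of the characteristic polynomial. The index \<open>j\<close> in \<open>sing_val j X\<close>
  starts at 1, so that \<open>sing_val 1 X\<close> is the largest singular value.\<close>

definition singular_values :: "complex mat \<Rightarrow> real multiset" where
  "singular_values X =
     image_mset (\<lambda>z. sqrt (Re z)) (proots (char_poly (mat_adjoint X * X)))"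

definition sing_val :: "nat \<Rightarrow> complex mat \<Rightarrow> real" where
  "sing_val j X = rev (sorted_list_of_multiset (singular_values X)) ! (j - 1)"

text \<open>\<open>fun_calc f X\<close> is \<open>f(X)\<close> for Hermitian \<open>X\<close>, given by any unitary diagonalization of \<open>X\<close>;
  the result does not depend on the diagonalization chosen. For positive semidefinite \<open>X\<close> only
  the values of \<open>f\<close> on \<open>[0,\<infinity>)\<close> matter.\<close>

definition fun_calc :: "(real \<Rightarrow> real) \<Rightarrow> complex mat \<Rightarrow> complex mat" where
  "fun_calc f X = (THE Y. \<exists>U d.
      U \<in> carrier_mat (dim_row X) (dim_row X) \<and>
      U * mat_adjoint U = 1\<^sub>m (dim_row X) \<and>
      mat_adjoint U * U = 1\<^sub>m (dim_row X) \<and>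
      X = U * mat_diag (dim_row X) (\<lambda>i. complex_of_real (d i)) * mat_adjoint U \<and>
      Y = U * mat_diag (dim_row X) (\<lambda>i. complex_of_real (f (d i))) * mat_adjoint U)"

text \<open>Operator monotonicity on \<open>[0,\<infinity>)\<close> is monotonicity for the Loewner order on positive
  semidefinite matrices of every size.\<close>

definition operator_monotone :: "(real \<Rightarrow> real) \<Rightarrow> bool" where
  "operator_monotone f \<longleftrightarrow>
     (\<forall>n A B. psd n A \<longrightarrow> psd n B \<longrightarrow> psd n (B - A) \<longrightarrow> psd n (fun_calc f B - fun_calc f A))"

definition representing_function :: "(real \<Rightarrow> real) \<Rightarrow> bool" where
  "representing_function h \<longleftrightarrow> (\<forall>x\<ge>0. 0 \<le> h x) \<and> operator_monotone h \<and> h 1 = 1"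

text \<open>\<open>A\<^sup>1\<^sup>/\<^sup>2 h(A\<^sup>-\<^sup>1\<^sup>/\<^sup>2 B A\<^sup>-\<^sup>1\<^sup>/\<^sup>2) A\<^sup>1\<^sup>/\<^sup>2\<close>, meaningful for invertible positive \<open>A\<close> and \<open>B\<close>.\<close>

definition inv_mean :: "(real \<Rightarrow> real) \<Rightarrow> complex mat \<Rightarrow> complex mat \<Rightarrow> complex mat" where
  "inv_mean h A B =
     fun_calc sqrt A *
     fun_calc h (fun_calc (\<lambda>x. x powr (-1/2)) A * B * fun_calc (\<lambda>x. x powr (-1/2)) A) *
     fun_calc sqrt A"

definition add_eps :: "complex mat \<Rightarrow> real \<Rightarrow> complex mat" where
  "add_eps A \<epsilon> = A + complex_of_real \<epsilon> \<cdot>\<^sub>m 1\<^sub>m (dim_row A)"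

text \<open>The mean with representing function \<open>h\<close>; the matrix limit is taken entrywise.\<close>

definition op_mean :: "(real \<Rightarrow> real) \<Rightarrow> complex mat \<Rightarrow> complex mat \<Rightarrow> complex mat" where
  "op_mean h A B =
     (if invertible_mat A \<and> invertible_mat B then inv_mean h A B
      else Matrix.mat (dim_row A) (dim_row A)
        (\<lambda>(i, j). Lim (at_right 0) (\<lambda>\<epsilon>. inv_mean h (add_eps A \<epsilon>) (add_eps B \<epsilon>) $$ (i, j))))"

definition scalar_mat :: "real \<Rightarrow> complex mat" where
  "scalar_mat a = Matrix.mat 1 1 (\<lambda>_. complex_of_real a)"

definition scalar_mean :: "(real \<Rightarrow> real) \<Rightarrow> real \<Rightarrow> real \<Rightarrow> real" where
  "scalar_mean h a b = Re (op_mean h (scalar_mat a) (scalar_mat b) $$ (0, 0))"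

text \<open>\<open>x\<^sup>\<alpha>\<close> for \<open>x, \<alpha> \<ge> 0\<close> with the convention \<open>0\<^sup>0 = 1\<close>, whereas \<open>0 powr 0 = 0\<close>.\<close>

definition rpow :: "real \<Rightarrow> real \<Rightarrow> real" where
  "rpow x \<alpha> = (if \<alpha> = 0 then 1 else x powr \<alpha>)"

end

theory Submission
  imports Defs
begin

text \<open>
  The idea is that both matrices and all the means between them can be diagonalized at once by a
  congruence. If \<open>A\<close> and \<open>B\<close> are positive definite, there are an invertible \<open>S\<close> and positive reals
  \<open>e\<^sub>i\<close> with \<open>A = S S\<^sup>*\<close> and \<open>B = S diag(e) S\<^sup>*\<close>, and then \<open>A \<sigma> B = S diag(h(e)) S\<^sup>*\<close>
  (\<open>inv_mean_congruence\<close>). In particular the weighted geometric means are \<open>C\<^sub>t = S diag(e\<^sup>t) S\<^sup>*\<close>, and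
  \<open>A \<sigma> B\<close> is the average of the \<open>C\<^sub>t\<close> over \<open>\<nu>\<close>. Write \<open>\<beta>(X)\<close> for the product of the \<open>k\<close> smallest
  eigenvalues of \<open>X\<close>.

  For a single exponent the claim is \<open>\<beta>(A)\<^sup>1\<^sup>-\<^sup>t \<beta>(B)\<^sup>t \<le> \<beta>(C\<^sub>t)\<close>
  (\<open>prod_smallest_geometric_mean\<close>). Let the columns of \<open>V\<close> be orthonormal eigenvectors of \<open>C\<^sub>t\<close> for
  its \<open>k\<close> smallest eigenvalues, so that \<open>1 / \<beta>(C\<^sub>t) = det (V\<^sup>* C\<^sub>t\<^sup>-\<^sup>1 V)\<close>. Since \<open>C\<^sub>t\<^sup>-\<^sup>1\<close> depends on \<open>t\<close>
  only through the entries \<open>e\<^sub>i\<^sup>-\<^sup>t\<close> of a diagonal matrix, this determinant is log-convex in \<open>t\<close>: after a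
  simultaneous diagonalization of the compressions at \<open>t = 0\<close> and \<open>t = 1\<close>, this is Hadamard's inequality
  followed by Jensen's inequality in each diagonal entry (\<open>det_compression_powr_le\<close>). At the two ends,
  \<open>det (V\<^sup>* A\<^sup>-\<^sup>1 V) \<le> 1 / \<beta>(A)\<close>, and likewise for \<open>B\<close> (\<open>det_inverse_compression_le\<close>). Hadamard's
  inequality and the last estimate both come from one fact: for orthonormal \<open>v\<^sub>1, \<dots>, v\<^sub>k\<close>, the
  product of the \<open>\<langle>X v\<^sub>j, v\<^sub>j\<rangle>\<close> is at least \<open>\<beta>(X)\<close> (\<open>prod_diag_ge_prod_smallest\<close>).

  To pass to the average, let \<open>v\<^sub>1, \<dots>, v\<^sub>k\<close> be eigenvectors of \<open>C = A \<sigma> B\<close> for its smallest eigenvalues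
  \<open>c\<^sub>j\<close>, and let \<open>g = \<beta>(C)\<^sup>1\<^sup>/\<^sup>k\<close>. By the arithmetic-geometric mean inequality, \<open>\<beta>(C\<^sub>t)\<^sup>1\<^sup>/\<^sup>k\<close> is at most
  the mean of the numbers \<open>(g / c\<^sub>j) \<langle>C\<^sub>t v\<^sub>j, v\<^sub>j\<rangle>\<close>. This bound is linear in \<open>C\<^sub>t\<close>, and
  integrating it over \<open>\<nu>\<close> gives exactly \<open>g\<close> (\<open>smallest_inv_mean_ge\<close>).

  If \<open>A\<close> or \<open>B\<close> is singular, the mean is a limit of means of \<open>A + \<epsilon>\<close> and \<open>B + \<epsilon>\<close>. The limit exists
  because the mean is monotone in both arguments (\<open>inv_mean_mono\<close>), which follows from
  writing \<open>x\<^sup>t\<close> as a superposition of the functions \<open>x / (x + s)\<close> and from the variational description of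
  the parallel sum. The inequality survives in the limit because the product of the
  \<open>\<langle>X v\<^sub>j, v\<^sub>j\<rangle>\<close> with fixed vectors is continuous in \<open>X\<close> and equals \<open>\<beta>(X)\<close> when the \<open>v\<^sub>j\<close> are the
  eigenvectors of the limit.
\<close>

section \<open>Adjoints and the spectral theorem\<close>

abbreviation adj :: "complex mat \<Rightarrow> complex mat" ("_\<^sup>\<dagger>" [1000] 1000) where
  "A\<^sup>\<dagger> \<equiv> mat_adjoint A"

abbreviation dg :: "nat \<Rightarrow> (nat \<Rightarrow> real) \<Rightarrow> complex mat" where
  "dg n d \<equiv> mat_diag n (\<lambda>i. complex_of_real (d i))"

lemma dim_adj [simp]: "dim_row A\<^sup>\<dagger> = dim_col A" "dim_col A\<^sup>\<dagger> = dim_row A"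
  by (simp_all add: mat_adjoint_def)

lemma adj_carrier [simp, intro]: "A \<in> carrier_mat n m \<Longrightarrow> A\<^sup>\<dagger> \<in> carrier_mat m n"
  by auto

lemma adj_index [simp]:
  "i < dim_col A \<Longrightarrow> j < dim_row A \<Longrightarrow> A\<^sup>\<dagger> $$ (i, j) = cnj (A $$ (j, i))"
  by (simp add: mat_adjoint_def mat_of_rows_index)

lemma adj_adj [simp]: "(A\<^sup>\<dagger>)\<^sup>\<dagger> = A"
  by (rule eq_matI) auto

lemma adj_mult: "A \<in> carrier_mat n m \<Longrightarrow> B \<in> carrier_mat m l \<Longrightarrow> (A * B)\<^sup>\<dagger> = B\<^sup>\<dagger> * A\<^sup>\<dagger>"
  by (rule eq_matI) (auto simp: scalar_prod_def mult.commute intro!: sum.cong)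

lemma adj_one [simp]: "(1\<^sub>m n)\<^sup>\<dagger> = 1\<^sub>m n"
  by (rule eq_matI) auto

lemma adj_dg [simp]: "(dg n d)\<^sup>\<dagger> = dg n d"
  by (rule eq_matI) (auto simp: mat_diag_def)

lemma index_mult_sum:
  "A \<in> carrier_mat n m \<Longrightarrow> B \<in> carrier_mat m l \<Longrightarrow> i < n \<Longrightarrow> j < l \<Longrightarrow>
    (A * B) $$ (i, j) = (\<Sum>p<m. A $$ (i, p) * B $$ (p, j))"
  by (auto simp: scalar_prod_def atLeast0LessThan)

text \<open>Completing an eigenvector to an orthonormal basis clears the first column of \<open>A\<close> below the diagonal;
  this is the induction step of the spectral theorem.\<close>

lemma exists_unitary_deflation:
  fixes A :: "complex mat"
  assumes A: "A \<in> carrier_mat n n" and n: "n \<noteq> 0"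
  obtains e W where "W \<in> carrier_mat n n" "W\<^sup>\<dagger> * W = 1\<^sub>m n"
    "\<And>i. i < n \<Longrightarrow> (W\<^sup>\<dagger> * A * W) $$ (i, 0) = (if i = 0 then e else 0)"
proof -
  from char_poly_factorized[OF A] obtain as where
    as: "char_poly A = (\<Prod>a\<leftarrow>as. [:- a, 1:])" "length as = n" by blast
  with n obtain e es where "as = e # es" by (cases as) auto
  with as have "poly (char_poly A) e = 0" by simp
  then have "eigenvalue A e" using eigenvalue_root_char_poly[OF A] by simp
  then obtain v where "eigenvector A v e" unfolding eigenvalue_def by blast
  then have v: "v \<in> carrier_vec n" and v0: "v \<noteq> 0\<^sub>v n" and ev: "A *\<^sub>v v = e \<cdot>\<^sub>v v"
    using A unfolding eigenvector_def by auto
  define b where "b = basis_completion v"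
  define ws where "ws = gram_schmidt n b"
  interpret cof_vec_space n "TYPE(complex)" .
  from basis_completion[OF v v0, folded b_def]
  have dist_b: "distinct b" and indep: "\<not> lin_dep (set b)" and b: "set b \<subseteq> carrier_vec n"
    and hdb: "hd b = v" and len_b: "length b = n" by auto
  from hdb len_b n obtain vs where bv: "b = v # vs" by (cases b, auto)
  from gram_schmidt_result[OF b dist_b indep refl, folded ws_def]
  have ws: "set ws \<subseteq> carrier_vec n" "corthogonal ws" "length ws = n"
    by (auto simp: len_b)
  from gram_schmidt_hd[OF v, of vs, folded bv] have hdws: "hd ws = v" unfolding ws_def .
  have ws0: "ws ! 0 = v" using hdws ws(3) n by (cases ws) auto
  have wsc: "ws ! i \<in> carrier_vec n" if "i < n" for i using that ws by auto
  define nr where "nr i = sqrt (\<Sum>p<n. (cmod (ws ! i $ p))\<^sup>2)" for i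
  have ip: "(\<Sum>p<n. cnj (ws ! i $ p) * ws ! j $ p) = (if i = j then of_real ((nr i)\<^sup>2) else 0)"
    if "i < n" "j < n" for i j
  proof (cases "i = j")
    case True
    have "(nr i)\<^sup>2 = (\<Sum>p<n. (cmod (ws ! i $ p))\<^sup>2)"
      unfolding nr_def by (rule real_sqrt_pow2) (simp add: sum_nonneg)
    then show ?thesis using True
      by (simp add: complex_norm_square mult.commute del: of_real_power)
  next
    case False
    have "ws ! j \<bullet>c ws ! i = 0" using corthogonalD[OF ws(2)] that False ws(3) by auto
    then show ?thesis using False wsc[OF that(1)] wsc[OF that(2)]
      by (auto simp: scalar_prod_def atLeast0LessThan mult.commute)
  qed
  have nr: "nr i > 0" if "i < n" for i
  proof -
    have "ws ! i \<bullet>c ws ! i \<noteq> 0" using corthogonalD[OF ws(2)] that ws(3) by auto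
    then have "(\<Sum>p<n. cnj (ws ! i $ p) * ws ! i $ p) \<noteq> 0" using wsc[OF that]
      by (auto simp: scalar_prod_def atLeast0LessThan mult.commute)
    then have "nr i \<noteq> 0" using ip[OF that that] by auto
    moreover have "nr i \<ge> 0" unfolding nr_def by (simp add: sum_nonneg)
    ultimately show ?thesis by simp
  qed
  define W where "W = Matrix.mat n n (\<lambda>(p, i). ws ! i $ p / of_real (nr i))"
  have W: "W \<in> carrier_mat n n" by (simp add: W_def)
  have WW: "W\<^sup>\<dagger> * W = 1\<^sub>m n"
  proof (rule eq_matI)
    fix i j assume "i < dim_row (1\<^sub>m n :: complex mat)" "j < dim_col (1\<^sub>m n :: complex mat)"
    then have ij: "i < n" "j < n" by auto
    have "(W\<^sup>\<dagger> * W) $$ (i, j) = (\<Sum>p<n. cnj (W $$ (p, i)) * W $$ (p, j))"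
      using ij W by (subst index_mult_sum[of _ n n _ n]) auto
    also have "\<dots> = (\<Sum>p<n. cnj (ws ! i $ p) * ws ! j $ p) / (of_real (nr i) * of_real (nr j))"
      using ij by (simp add: W_def sum_divide_distrib)
    also have "\<dots> = 1\<^sub>m n $$ (i, j)"
      using ij ip[OF ij] nr[OF ij(1)] nr[OF ij(2)] by (auto simp: power2_eq_square)
    finally show "(W\<^sup>\<dagger> * W) $$ (i, j) = 1\<^sub>m n $$ (i, j)" .
  qed (use W in auto)
  have col0: "(A * W) $$ (p, 0) = e * W $$ (p, 0)" if "p < n" for p
  proof -
    have "(A * W) $$ (p, 0) = (\<Sum>q<n. A $$ (p, q) * v $ q) / of_real (nr 0)"
      using that n A W by (subst index_mult_sum[of _ n n _ n])
        (auto simp: W_def ws0 sum_divide_distrib intro!: sum.cong)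
    also have "(\<Sum>q<n. A $$ (p, q) * v $ q) = (A *\<^sub>v v) $ p"
      using that A v by (auto simp: scalar_prod_def atLeast0LessThan intro!: sum.cong)
    also have "\<dots> = e * v $ p" using ev v that by simp
    finally show ?thesis using that n by (simp add: W_def ws0)
  qed
  have "(W\<^sup>\<dagger> * A * W) $$ (i, 0) = (if i = 0 then e else 0)" if "i < n" for i
  proof -
    have "W\<^sup>\<dagger> * A * W = W\<^sup>\<dagger> * (A * W)" using W A by (intro assoc_mult_mat) auto
    then have "(W\<^sup>\<dagger> * A * W) $$ (i, 0) = (\<Sum>p<n. W\<^sup>\<dagger> $$ (i, p) * (e * W $$ (p, 0)))"
      using that n A W col0 by (simp del: assoc_mult_mat index_mult_mat(1) adj_index 
        add: index_mult_sum[of _ n n _ n])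
    also have "\<dots> = e * (W\<^sup>\<dagger> * W) $$ (i, 0)"
      using that n W by (subst index_mult_sum[of _ n n _ n]) (auto simp: sum_distrib_left ac_simps)
    finally show ?thesis using that n by (auto simp: WW)
  qed
  with W WW show ?thesis using that by blast
qed

definition unitary :: "nat \<Rightarrow> complex mat \<Rightarrow> bool" where
  "unitary n U \<longleftrightarrow> U \<in> carrier_mat n n \<and> U * U\<^sup>\<dagger> = 1\<^sub>m n \<and> U\<^sup>\<dagger> * U = 1\<^sub>m n"

definition eigen_decomp :: "nat \<Rightarrow> complex mat \<Rightarrow> complex mat \<Rightarrow> (nat \<Rightarrow> real) \<Rightarrow> bool" where
  "eigen_decomp n X U d \<longleftrightarrow> unitary n U \<and> X = U * dg n d * U\<^sup>\<dagger>"

lemma unitaryI: "U \<in> carrier_mat n n \<Longrightarrow> U\<^sup>\<dagger> * U = 1\<^sub>m n \<Longrightarrow> unitary n U"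
  unfolding unitary_def using mat_mult_left_right_inverse[of "U\<^sup>\<dagger>" n U] by auto

lemma unitary_one [simp]: "unitary n (1\<^sub>m n)"
  by (simp add: unitary_def)

lemma dim_mat_diag [simp]: "dim_row (mat_diag n f) = n" "dim_col (mat_diag n f) = n"
  by (simp_all add: mat_diag_def)

text \<open>Side conditions on dimensions, instead of membership in carrier sets, leave no inner dimension to be
  guessed, so that products of many factors can be rebracketed by rewriting.\<close>

lemma mat_assoc:
  fixes A B C :: "complex mat"
  shows "dim_col A = dim_row B \<Longrightarrow> dim_col B = dim_row C \<Longrightarrow> A * B * C = A * (B * C)"
  by (rule assoc_mult_mat) auto

lemma adj_mult_dim: "dim_col A = dim_row B \<Longrightarrow> (A * B)\<^sup>\<dagger> = B\<^sup>\<dagger> * A\<^sup>\<dagger>"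
  by (rule adj_mult) auto

lemma unitary_cancel:
  assumes "unitary n U" "dim_row M = n"
  shows "U\<^sup>\<dagger> * (U * M) = M" "U * (U\<^sup>\<dagger> * M) = M"
  using assms assoc_mult_mat[of "U\<^sup>\<dagger>" n n U n M "dim_col M"] assoc_mult_mat[of U n n "U\<^sup>\<dagger>" n M "dim_col M"]
  by (auto simp: unitary_def simp del: assoc_mult_mat)

lemma unitary_cancel_right:
  assumes "unitary n U" "dim_col M = n"
  shows "M * U * U\<^sup>\<dagger> = M" "M * U\<^sup>\<dagger> * U = M"
  using assms assoc_mult_mat[of M "dim_row M" n "U\<^sup>\<dagger>" n U n] assoc_mult_mat[of M "dim_row M" n U n "U\<^sup>\<dagger>" n]
  by (auto simp: unitary_def simp del: assoc_mult_mat)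

lemma dg_carrier [simp]: "dg n d \<in> carrier_mat n n"
  by simp

lemma index_congruence_dg:
  assumes "S \<in> carrier_mat n k" "i < n" "j < n"
  shows "(S * dg k d * S\<^sup>\<dagger>) $$ (i, j) = (\<Sum>p<k. S $$ (i, p) * of_real (d p) * cnj (S $$ (j, p)))"
  using assms by (subst mat_diag_mult_right, blast, subst index_mult_sum[of _ n k _ n]) auto

lemma index_congruence_dg':
  assumes "Z \<in> carrier_mat n k" "i < k" "j < k"
  shows "(Z\<^sup>\<dagger> * dg n d * Z) $$ (i, j) = (\<Sum>p<n. cnj (Z $$ (p, i)) * of_real (d p) * Z $$ (p, j))"
  using assms index_congruence_dg[of "Z\<^sup>\<dagger>" k n i j d] by auto

lemma unitary_mult:
  assumes "unitary n U" "unitary n V"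
  shows "unitary n (U * V)"
proof (rule unitaryI)
  have c: "U \<in> carrier_mat n n" "V \<in> carrier_mat n n" using assms by (auto simp: unitary_def)
  then show "U * V \<in> carrier_mat n n" by auto
  have "(U * V)\<^sup>\<dagger> * (U * V) = V\<^sup>\<dagger> * (U\<^sup>\<dagger> * (U * V))"
    using c by (simp add: adj_mult_dim mat_assoc)
  also have "\<dots> = 1\<^sub>m n" using unitary_cancel(1)[OF assms(1), of V] c assms(2) by (simp add: unitary_def)
  finally show "(U * V)\<^sup>\<dagger> * (U * V) = 1\<^sub>m n" .
qed

lemma eigen_decomp_conj:
  assumes W: "unitary n W" and V: "eigen_decomp n (W\<^sup>\<dagger> * A * W) V d" and A: "A \<in> carrier_mat n n"
  shows "eigen_decomp n A (W * V) d"
proof -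
  have c: "W \<in> carrier_mat n n" "V \<in> carrier_mat n n" using W V by (auto simp: unitary_def eigen_decomp_def)
  have "A = W * (W\<^sup>\<dagger> * A * W) * W\<^sup>\<dagger>"
    using unitary_cancel[OF W, of "A * W"] unitary_cancel_right[OF W, of A] c A
    by (simp add: mat_assoc)
  also have "W\<^sup>\<dagger> * A * W = V * dg n d * V\<^sup>\<dagger>" using V by (simp add: eigen_decomp_def)
  also have "W * (V * dg n d * V\<^sup>\<dagger>) * W\<^sup>\<dagger> = (W * V) * dg n d * (W * V)\<^sup>\<dagger>"
    using c by (simp add: adj_mult_dim mat_assoc)
  finally show ?thesis using unitary_mult[OF W] V by (simp add: eigen_decomp_def)
qed

lemma adj_four_block:
  assumes "A \<in> carrier_mat n n" "B \<in> carrier_mat m m"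
  shows "(four_block_mat A (0\<^sub>m n m) (0\<^sub>m m n) B)\<^sup>\<dagger> = four_block_mat A\<^sup>\<dagger> (0\<^sub>m n m) (0\<^sub>m m n) B\<^sup>\<dagger>"
  using assms by (intro eq_matI) auto

text \<open>Conjugating with the unitary of the deflation lemma keeps the matrix Hermitian, so its first row is
  cleared too, and the remaining block is diagonalized by induction.\<close>

lemma hermitian_eigen_decomp:
  assumes "A \<in> carrier_mat n n" "A\<^sup>\<dagger> = A"
  shows "\<exists>U d. eigen_decomp n A U d"
  using assms
proof (induction n arbitrary: A)
  case 0
  then have "eigen_decomp 0 A (1\<^sub>m 0) (\<lambda>_. 0)"
    by (auto simp: eigen_decomp_def intro!: eq_matI)
  then show ?case by blast
next
  case (Suc m)
  let ?n = "Suc m"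
  obtain e W where W: "W \<in> carrier_mat ?n ?n" "W\<^sup>\<dagger> * W = 1\<^sub>m ?n"
    and col: "\<And>i. i < ?n \<Longrightarrow> (W\<^sup>\<dagger> * A * W) $$ (i, 0) = (if i = 0 then e else 0)"
    using exists_unitary_deflation[OF Suc.prems(1)] by blast
  define A' where "A' = W\<^sup>\<dagger> * A * W"
  have A': "A' \<in> carrier_mat ?n ?n" using W Suc.prems by (auto simp: A'_def)
  have "A'\<^sup>\<dagger> = A'" using W Suc.prems
    by (simp add: A'_def adj_mult_dim mat_assoc)
  then have herm: "A' $$ (i, j) = cnj (A' $$ (j, i))" if "i < ?n" "j < ?n" for i j
    using that A' adj_index[of i A' j] by auto
  have "e = cnj e" using herm[of 0 0] col[of 0] by (simp add: A'_def)
  then have e: "of_real (Re e) = e" by (metis Reals_cnj_iff of_real_Re)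
  define A3 where "A3 = Matrix.mat m m (\<lambda>(i, j). A' $$ (Suc i, Suc j))"
  have A3: "A3 \<in> carrier_mat m m" by (simp add: A3_def)
  have "A3\<^sup>\<dagger> = A3" by (rule eq_matI) (auto simp: A3_def herm[symmetric])
  from Suc.IH[OF A3 this] obtain V d where V: "eigen_decomp m A3 V d" by blast
  then have Vc: "V \<in> carrier_mat m m" and VV: "V\<^sup>\<dagger> * V = 1\<^sub>m m" and A3_eq: "A3 = V * dg m d * V\<^sup>\<dagger>"
    by (auto simp: eigen_decomp_def unitary_def)
  define V' where "V' = four_block_mat (1\<^sub>m 1) (0\<^sub>m 1 m) (0\<^sub>m m 1) V"
  define d' where "d' = case_nat (Re e) d"
  have V': "V' \<in> carrier_mat ?n ?n" using Vc by (auto simp: V'_def)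
  have V'a: "V'\<^sup>\<dagger> = four_block_mat (1\<^sub>m 1) (0\<^sub>m 1 m) (0\<^sub>m m 1) V\<^sup>\<dagger>"
    unfolding V'_def using Vc by (subst adj_four_block) auto
  have dg': "dg ?n d' = four_block_mat (dg 1 (\<lambda>_. Re e)) (0\<^sub>m 1 m) (0\<^sub>m m 1) (dg m d)"
    by (rule eq_matI) (auto simp: mat_diag_def d'_def split: nat.splits)
  have A'4: "A' = four_block_mat (dg 1 (\<lambda>_. Re e)) (0\<^sub>m 1 m) (0\<^sub>m m 1) A3"
  proof (rule eq_matI)
    fix i j
    assume "i < dim_row (four_block_mat (dg 1 (\<lambda>_. Re e)) (0\<^sub>m 1 m) (0\<^sub>m m 1) A3)"
      "j < dim_col (four_block_mat (dg 1 (\<lambda>_. Re e)) (0\<^sub>m 1 m) (0\<^sub>m m 1) A3)"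
    then have ij: "i < ?n" "j < ?n" using A3 by (auto simp: mat_diag_def)
    show "A' $$ (i, j) = four_block_mat (dg 1 (\<lambda>_. Re e)) (0\<^sub>m 1 m) (0\<^sub>m m 1) A3 $$ (i, j)"
    proof (cases "j = 0")
      case True
      then show ?thesis using ij A3 col[OF ij(1)] e by (auto simp: A'_def[symmetric] mat_diag_def)
    next
      case False
      then show ?thesis
      proof (cases "i = 0")
        case True
        then show ?thesis using False ij A3 col[OF ij(2)] herm[of 0 j]
          by (auto simp: A'_def[symmetric] mat_diag_def)
      next
        case False
        then show ?thesis using \<open>j \<noteq> 0\<close> ij A3 by (auto simp: A3_def mat_diag_def)
      qed
    qed
  qed (use A' A3 in \<open>auto simp: mat_diag_def\<close>)
  have "V' * dg ?n d' = four_block_mat (dg 1 (\<lambda>_. Re e)) (0\<^sub>m 1 m) (0\<^sub>m m 1) (V * dg m d)"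
    unfolding dg' V'_def using Vc
    by (subst mult_four_block_mat[of _ 1 1 _ m _ m _ _ 1 _ m]) auto
  then have "V' * dg ?n d' * V'\<^sup>\<dagger> = A'"
    unfolding V'a A'4 A3_eq using Vc
    by (simp, subst mult_four_block_mat[of _ 1 1 _ m _ m _ _ 1 _ m])
      (auto simp del: assoc_mult_mat)
  moreover have "V'\<^sup>\<dagger> * V' = 1\<^sub>m ?n"
    unfolding V'a unfolding V'_def using Vc VV
    by (subst mult_four_block_mat[of _ 1 1 _ m _ m _ _ 1 _ m], auto)
  ultimately have "eigen_decomp ?n A' V' d'"
    using unitaryI[OF V'] by (simp add: eigen_decomp_def)
  then show ?case using eigen_decomp_conj[OF unitaryI[OF W], of A V' d'] Suc.prems(1)
    by (auto simp: A'_def)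
qed

text \<open>Eigenvalues in increasing order turn the product of the \<open>k\<close> smallest ones into a product over
  \<open>{..<k}\<close>.\<close>

lemma eigen_decomp_sort:
  assumes "eigen_decomp n A U d"
  shows "\<exists>U d. eigen_decomp n A U d \<and> mono_on {..<n} d"
proof -
  have U: "U \<in> carrier_mat n n" and UU: "U\<^sup>\<dagger> * U = 1\<^sub>m n" and A: "A = U * dg n d * U\<^sup>\<dagger>"
    using assms by (auto simp: eigen_decomp_def unitary_def)
  define ps where "ps = sort_key d [0..<n]"
  define p where "p = (\<lambda>j. ps ! j)"
  have len: "length ps = n" and dist: "distinct ps" and set: "set ps = {..<n}"
    by (auto simp: ps_def)
  have p: "bij_betw p {..<n} {..<n}"
    unfolding p_def by (rule bij_betw_nth) (use dist len set in auto)
  then have pn: "p i < n" if "i < n" for i using that bij_betwE by blast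
  have inj: "p i = p j \<longleftrightarrow> i = j" if "i < n" "j < n" for i j
    using p that by (auto simp: bij_betw_def inj_on_def)
  define U' where "U' = Matrix.mat n n (\<lambda>(i, j). U $$ (i, p j))"
  have U': "U' \<in> carrier_mat n n" by (simp add: U'_def)
  have "U'\<^sup>\<dagger> * U' = 1\<^sub>m n"
  proof (rule eq_matI)
    fix i j assume "i < dim_row (1\<^sub>m n :: complex mat)" "j < dim_col (1\<^sub>m n :: complex mat)"
    then have ij: "i < n" "j < n" by auto
    have "(U'\<^sup>\<dagger> * U') $$ (i, j) = (U\<^sup>\<dagger> * U) $$ (p i, p j)"
      using ij pn U U' by (simp add: index_mult_sum[of _ n n _ n] del: index_mult_mat(1))
        (simp add: U'_def)
    then show "(U'\<^sup>\<dagger> * U') $$ (i, j) = 1\<^sub>m n $$ (i, j)"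
      using ij pn inj by (simp add: UU)
  qed (use U' in auto)
  moreover have "A = U' * dg n (d \<circ> p) * U'\<^sup>\<dagger>"
  proof (rule eq_matI)
    fix i j assume "i < dim_row (U' * dg n (d \<circ> p) * U'\<^sup>\<dagger>)" "j < dim_col (U' * dg n (d \<circ> p) * U'\<^sup>\<dagger>)"
    then have ij: "i < n" "j < n" using U' by auto
    have "A $$ (i, j) = (\<Sum>q<n. U $$ (i, q) * of_real (d q) * cnj (U $$ (j, q)))"
      unfolding A by (rule index_congruence_dg[OF U ij])
    also have "\<dots> = (\<Sum>q<n. U $$ (i, p q) * of_real (d (p q)) * cnj (U $$ (j, p q)))"
      by (rule sum.reindex_bij_betw[OF p, symmetric])
    also have "\<dots> = (U' * dg n (d \<circ> p) * U'\<^sup>\<dagger>) $$ (i, j)"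
      by (subst index_congruence_dg[OF U' ij]) (use ij in \<open>auto simp: U'_def\<close>)
    finally show "A $$ (i, j) = (U' * dg n (d \<circ> p) * U'\<^sup>\<dagger>) $$ (i, j)" .
  qed (use U U' A in auto)
  moreover have "mono_on {..<n} (d \<circ> p)"
  proof (rule mono_onI)
    fix i j assume "i \<in> {..<n}" "j \<in> {..<n}" "i \<le> j"
    moreover have "sorted (map d ps)" by (simp add: ps_def)
    ultimately show "(d \<circ> p) i \<le> (d \<circ> p) j"
      using sorted_nth_mono[of "map d ps" i j] len by (simp add: p_def)
  qed
  ultimately show ?thesis using unitaryI[OF U'] unfolding eigen_decomp_def by blast
qed

section \<open>Functional calculus and singular values\<close>

text \<open>The definite description in the functional calculus is justified here: all unitary
  diagonalizations of \<open>X\<close> give the same matrix.\<close>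

lemma fun_calc_eq:
  assumes "eigen_decomp n X U d"
  shows "fun_calc f X = U * dg n (\<lambda>i. f (d i)) * U\<^sup>\<dagger>"
proof -
  have U: "U \<in> carrier_mat n n" "U * U\<^sup>\<dagger> = 1\<^sub>m n" "U\<^sup>\<dagger> * U = 1\<^sub>m n" and X: "X = U * dg n d * U\<^sup>\<dagger>"
    using assms by (auto simp: eigen_decomp_def unitary_def)
  have n: "dim_row X = n" using U X by auto
  show ?thesis unfolding fun_calc_def n
  proof (rule the_equality, goal_cases)
    case 1
    show ?case using U X by blast
  next
    case (2 Y)
    then obtain V c where V: "V \<in> carrier_mat n n" "V * V\<^sup>\<dagger> = 1\<^sub>m n" "V\<^sup>\<dagger> * V = 1\<^sub>m n"
      and XV: "X = V * dg n c * V\<^sup>\<dagger>" and Y: "Y = V * dg n (\<lambda>i. f (c i)) * V\<^sup>\<dagger>" by blast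
    have Vu: "unitary n V" and Uu: "unitary n U" using U V by (auto simp: unitary_def)
    define W where "W = V\<^sup>\<dagger> * U"
    have W: "W \<in> carrier_mat n n" using U V by (auto simp: W_def)
    have VW: "V * W = U" unfolding W_def using unitary_cancel(2)[OF Vu, of U] U by auto
    have "V\<^sup>\<dagger> * X * U = V\<^sup>\<dagger> * (V * (dg n c * W))"
      using U V unfolding XV W_def by (simp add: mat_assoc)
    then have 1: "V\<^sup>\<dagger> * X * U = dg n c * W" using unitary_cancel(1)[OF Vu, of "dg n c * W"] W by auto
    have "V\<^sup>\<dagger> * X * U = W * dg n d * U\<^sup>\<dagger> * U"
      using U V unfolding X W_def by (simp add: mat_assoc)
    then have 2: "V\<^sup>\<dagger> * X * U = W * dg n d" using unitary_cancel_right(2)[OF Uu, of "W * dg n d"] W by auto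
    have comm: "dg n c * W = W * dg n d" using 1 2 by simp
    \<comment> \<open>The unitary \<open>W\<close> intertwines the two diagonal matrices, so its entry \<open>(i, j)\<close> vanishes unless
      \<open>c i = d j\<close>; hence it intertwines their images under \<open>f\<close> as well.\<close>
    have "dg n (\<lambda>i. f (c i)) * W = W * dg n (\<lambda>i. f (d i))"
    proof (rule eq_matI)
      fix i j assume "i < dim_row (W * dg n (\<lambda>i. f (d i)))" "j < dim_col (W * dg n (\<lambda>i. f (d i)))"
      then have ij: "i < n" "j < n" using W by (auto simp: mat_diag_def)
      have "of_real (c i) * W $$ (i, j) = W $$ (i, j) * of_real (d j)"
        using arg_cong[OF comm, of "\<lambda>M. M $$ (i, j)"] ij W
        by (simp add: mat_diag_mult_left[OF W] mat_diag_mult_right[OF W])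
      then have "W $$ (i, j) = 0 \<or> c i = d j" by auto
      then show "(dg n (\<lambda>i. f (c i)) * W) $$ (i, j) = (W * dg n (\<lambda>i. f (d i))) $$ (i, j)"
        using ij W by (auto simp: mat_diag_mult_left[OF W] mat_diag_mult_right[OF W])
    qed (use W in \<open>auto simp: mat_diag_def\<close>)
    then have "V * (dg n (\<lambda>i. f (c i)) * W) = U * dg n (\<lambda>i. f (d i))"
      using VW V W assoc_mult_mat[of V n n W n "dg n (\<lambda>i. f (d i))" n] by simp
    then have "V * (dg n (\<lambda>i. f (c i)) * W) * U\<^sup>\<dagger> = U * dg n (\<lambda>i. f (d i)) * U\<^sup>\<dagger>" by simp
    moreover have "V * (dg n (\<lambda>i. f (c i)) * W) * U\<^sup>\<dagger> = V * dg n (\<lambda>i. f (c i)) * V\<^sup>\<dagger> * U * U\<^sup>\<dagger>"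
      using U V unfolding W_def by (simp add: mat_assoc)
    ultimately show ?case
      using unitary_cancel_right(1)[OF Uu, of "V * dg n (\<lambda>i. f (c i)) * V\<^sup>\<dagger>"] V unfolding Y by auto
  qed
qed

text \<open>For a positive semidefinite matrix the singular values are the eigenvalues. They are numbered in
  decreasing order starting from 1, and \<open>d\<close> is increasing starting from 0, hence the index \<open>n - j\<close>.\<close>

lemma sing_val_eigen:
  assumes X: "eigen_decomp n X U d" and mono: "mono_on {..<n} d" and d0: "\<And>i. i < n \<Longrightarrow> 0 \<le> d i"
    and j: "1 \<le> j" "j \<le> n"
  shows "sing_val j X = d (n - j)"
proof -
  have U: "U \<in> carrier_mat n n" "U * U\<^sup>\<dagger> = 1\<^sub>m n" "U\<^sup>\<dagger> * U = 1\<^sub>m n" and XU: "X = U * dg n d * U\<^sup>\<dagger>"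
    and Uu: "unitary n U"
    using X by (auto simp: eigen_decomp_def unitary_def)
  have Xc: "X \<in> carrier_mat n n" using U XU by auto
  let ?D = "dg n (\<lambda>i. d i * d i)"
  have "X\<^sup>\<dagger> * X = U * ?D * U\<^sup>\<dagger>"
  proof -
    have "X\<^sup>\<dagger> * X = U * (dg n d * (U\<^sup>\<dagger> * (U * (dg n d * U\<^sup>\<dagger>))))"
      unfolding XU using U by (simp add: adj_mult_dim mat_assoc)
    also have "U\<^sup>\<dagger> * (U * (dg n d * U\<^sup>\<dagger>)) = dg n d * U\<^sup>\<dagger>"
      using unitary_cancel(1)[OF Uu, of "dg n d * U\<^sup>\<dagger>"] U by auto
    also have "U * (dg n d * (dg n d * U\<^sup>\<dagger>)) = U * (dg n d * dg n d) * U\<^sup>\<dagger>"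
      using U by (simp add: mat_assoc del: mat_diag_diag)
    finally show ?thesis by simp
  qed
  then have "similar_mat (X\<^sup>\<dagger> * X) ?D"
    using U Xc by (intro similar_matI[of _ _ U "U\<^sup>\<dagger>" n]) auto
  then have "char_poly (X\<^sup>\<dagger> * X) = char_poly ?D" by (rule char_poly_similar)
  also have "\<dots> = (\<Prod>a\<leftarrow>diag_mat ?D. [:- a, 1:])"
    by (rule char_poly_upper_triangular[of _ n]) (auto simp: mat_diag_def)
  finally have cp: "char_poly (X\<^sup>\<dagger> * X) = (\<Prod>a\<leftarrow>diag_mat ?D. [:- a, 1:])" .
  have diag: "diag_mat ?D = map (\<lambda>i. of_real (d i * d i)) [0..<n]"
    by (auto simp: diag_mat_def mat_diag_def)
  have proots_lin: "proots (\<Prod>a\<leftarrow>xs. [:- a, 1:]) = mset xs" for xs :: "complex list"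
  proof (induction xs)
    case (Cons a xs)
    have "(\<Prod>a\<leftarrow>xs. [:- a, 1:]) \<noteq> 0" by (auto simp: prod_list_zero_iff)
    then show ?case using Cons by (simp add: proots_mult del: mult_pCons_left)
  qed simp
  have "singular_values X = mset (map (\<lambda>i. sqrt (d i * d i)) [0..<n])"
    unfolding singular_values_def cp proots_lin unfolding diag
    by (simp add: image_mset.compositionality comp_def flip: of_real_mult)
  also have "map (\<lambda>i. sqrt (d i * d i)) [0..<n] = map d [0..<n]"
    using d0 by auto
  finally have sv: "singular_values X = mset (map d [0..<n])" .
  have "sorted (map d [0..<n])"
    using mono by (auto simp: sorted_iff_nth_mono mono_on_def)
  then have "sorted_list_of_multiset (singular_values X) = map d [0..<n]"
    unfolding sv by (simp only: sorted_list_of_multiset_mset sorted_sort_id)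
  then show ?thesis using j unfolding sing_val_def
    by (simp add: rev_nth)
qed

lemma prod_sing_val_eigen:
  assumes "eigen_decomp n X U d" "mono_on {..<n} d" "\<And>i. i < n \<Longrightarrow> 0 \<le> d i" "k \<le> n"
  shows "(\<Prod>j = n + 1 - k..n. sing_val j X) = (\<Prod>i<k. d i)"
proof -
  have "(\<Prod>j = n + 1 - k..n. sing_val j X) = (\<Prod>j = n + 1 - k..n. d (n - j))"
    using assms by (intro prod.cong refl sing_val_eigen[OF assms(1,2,3)]) auto
  also have "\<dots> = (\<Prod>i<k. d i)"
    by (rule prod.reindex_bij_witness[of _ "\<lambda>i. n - i" "\<lambda>j. n - j"]) (use assms(4) in auto)
  finally show ?thesis .
qed

section \<open>Quadratic forms and positive definite matrices\<close>

lemma mult_carrier_dim [simp]: "dim_row A = n \<Longrightarrow> dim_col B = m \<Longrightarrow> A * B \<in> carrier_mat n m"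
  by auto

lemma dg_dg: "dg n f * dg n g = dg n (\<lambda>i. f i * g i)"
  by simp

lemma dg_cong: "(\<And>i. i < n \<Longrightarrow> f i = g i) \<Longrightarrow> dg n f = dg n g"
  by (rule eq_matI) (auto simp: mat_diag_def)

lemma dg_eq_one: "(\<And>i. i < n \<Longrightarrow> f i = 1) \<Longrightarrow> dg n f = 1\<^sub>m n"
  by (rule eq_matI) (auto simp: mat_diag_def)

text \<open>For Hermitian \<open>M\<close> the inner product is real; taking the real part makes the values comparable.\<close>

definition qf :: "complex mat \<Rightarrow> complex vec \<Rightarrow> real" where
  "qf M v = Re ((M *\<^sub>v v) \<bullet>c v)"

definition pd :: "nat \<Rightarrow> complex mat \<Rightarrow> bool" where
  "pd n A \<longleftrightarrow> A \<in> carrier_mat n n \<and> A\<^sup>\<dagger> = A \<and> (\<forall>v \<in> carrier_vec n. v \<noteq> 0\<^sub>v n \<longrightarrow> 0 < qf A v)"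

lemma index_mult_vec_sum:
  "A \<in> carrier_mat n m \<Longrightarrow> v \<in> carrier_vec m \<Longrightarrow> i < n \<Longrightarrow> (A *\<^sub>v v) $ i = (\<Sum>j<m. A $$ (i, j) * v $ j)"
  by (auto simp: scalar_prod_def atLeast0LessThan)

lemma mult_vec_carrier [simp]: "dim_row A = n \<Longrightarrow> A *\<^sub>v v \<in> carrier_vec n"
  by (auto intro!: carrier_vecI)

lemma mult_zero_vec: "A \<in> carrier_mat n m \<Longrightarrow> A *\<^sub>v 0\<^sub>v m = (0\<^sub>v n :: complex vec)"
  by (intro eq_vecI) (auto simp: scalar_prod_def)

lemma cscalar_sum:
  "u \<in> carrier_vec n \<Longrightarrow> v \<in> carrier_vec n \<Longrightarrow> u \<bullet>c v = (\<Sum>i<n. u $ i * cnj (v $ i))"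
  by (auto simp: scalar_prod_def atLeast0LessThan)

lemma adj_inner:
  assumes A: "A \<in> carrier_mat n m" and u: "u \<in> carrier_vec m" and v: "v \<in> carrier_vec n"
  shows "(A *\<^sub>v u) \<bullet>c v = u \<bullet>c (A\<^sup>\<dagger> *\<^sub>v v)"
proof -
  have "(A *\<^sub>v u) \<bullet>c v = (\<Sum>i<n. \<Sum>j<m. A $$ (i, j) * u $ j * cnj (v $ i))"
    using A u v by (subst cscalar_sum[of _ n])
      (auto simp: index_mult_vec_sum[OF A u] sum_distrib_right simp del: index_mult_mat_vec)
  also have "\<dots> = (\<Sum>j<m. \<Sum>i<n. A $$ (i, j) * u $ j * cnj (v $ i))" by (rule sum.swap)
  also have "\<dots> = (\<Sum>j<m. u $ j * cnj (\<Sum>i<n. cnj (A $$ (i, j)) * v $ i))"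
    by (auto simp: sum_distrib_left ac_simps)
  also have "\<dots> = (\<Sum>j<m. u $ j * cnj ((A\<^sup>\<dagger> *\<^sub>v v) $ j))"
    using A v by (intro sum.cong refl, subst index_mult_vec_sum[of _ m n]) auto
  also have "\<dots> = u \<bullet>c (A\<^sup>\<dagger> *\<^sub>v v)" using A u v by (subst cscalar_sum[of _ m]) auto
  finally show ?thesis .
qed

lemma inner_dg:
  assumes "w \<in> carrier_vec m"
  shows "(dg m d *\<^sub>v w) \<bullet>c w = of_real (\<Sum>i<m. d i * (cmod (w $ i))\<^sup>2)"
proof -
  have "(dg m d *\<^sub>v w) $ i = of_real (d i) * w $ i" if "i < m" for i
    using that assms by (subst index_mult_vec_sum[of _ m m])
      (auto simp: mat_diag_def if_distrib[of "\<lambda>x. x * _"] sum.delta cong: if_cong)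
  then have "(dg m d *\<^sub>v w) \<bullet>c w = (\<Sum>i<m. of_real (d i) * (w $ i * cnj (w $ i)))"
    using assms by (subst cscalar_sum[of _ m]) (auto simp: mult.assoc simp del: index_mult_mat_vec intro!: carrier_vecI)
  also have "\<dots> = of_real (\<Sum>i<m. d i * (cmod (w $ i))\<^sup>2)"
    by (simp only: of_real_sum of_real_mult complex_norm_square)
  finally show ?thesis .
qed

lemma inner_congruence:
  assumes S: "S \<in> carrier_mat n m" and M: "M \<in> carrier_mat m m" and v: "v \<in> carrier_vec n"
  shows "((S * M * S\<^sup>\<dagger>) *\<^sub>v v) \<bullet>c v = (M *\<^sub>v (S\<^sup>\<dagger> *\<^sub>v v)) \<bullet>c (S\<^sup>\<dagger> *\<^sub>v v)"
proof -
  have "(S * M * S\<^sup>\<dagger>) *\<^sub>v v = S *\<^sub>v (M *\<^sub>v (S\<^sup>\<dagger> *\<^sub>v v))"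
    using assoc_mult_mat_vec[of "S * M" n m "S\<^sup>\<dagger>" n v] assoc_mult_mat_vec[of S n m M m "S\<^sup>\<dagger> *\<^sub>v v"] S M v
    by (simp del: assoc_mult_mat_vec)
  then show ?thesis using adj_inner[OF S, of "M *\<^sub>v (S\<^sup>\<dagger> *\<^sub>v v)" v] S M v
    by simp
qed

lemma inner_congruence_dg:
  assumes "S \<in> carrier_mat n m" "v \<in> carrier_vec n"
  shows "((S * dg m d * S\<^sup>\<dagger>) *\<^sub>v v) \<bullet>c v = of_real (\<Sum>i<m. d i * (cmod ((S\<^sup>\<dagger> *\<^sub>v v) $ i))\<^sup>2)"
  unfolding inner_congruence[OF assms(1) dg_carrier assms(2)] by (rule inner_dg) (use assms in auto)

text \<open>All matrices of interest have the form \<open>S diag(d) S\<^sup>*\<close>. In the coordinates \<open>S\<^sup>* v\<close> their quadratic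
  forms are sums that depend linearly on \<open>d\<close>.\<close>

lemma qf_congruence_dg:
  assumes "S \<in> carrier_mat n m" "v \<in> carrier_vec n"
  shows "qf (S * dg m d * S\<^sup>\<dagger>) v = (\<Sum>i<m. d i * (cmod ((S\<^sup>\<dagger> *\<^sub>v v) $ i))\<^sup>2)"
  unfolding qf_def inner_congruence_dg[OF assms] by simp

lemma hermitian_congruence:
  assumes "S \<in> carrier_mat n m" "M \<in> carrier_mat m m" "M\<^sup>\<dagger> = M"
  shows "(S * M * S\<^sup>\<dagger>)\<^sup>\<dagger> = S * M * S\<^sup>\<dagger>"
  using assms by (simp add: adj_mult_dim mat_assoc)

lemma eigen_decomp_carrier:
  "eigen_decomp n X U d \<Longrightarrow> U \<in> carrier_mat n n"
  "eigen_decomp n X U d \<Longrightarrow> X \<in> carrier_mat n n"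
  by (auto simp: eigen_decomp_def unitary_def)

lemma eigen_decomp_hermitian: "eigen_decomp n X U d \<Longrightarrow> X\<^sup>\<dagger> = X"
  unfolding eigen_decomp_def unitary_def by (auto intro!: hermitian_congruence)

lemma qf_eigen:
  "eigen_decomp n X U d \<Longrightarrow> v \<in> carrier_vec n \<Longrightarrow> qf X v = (\<Sum>i<n. d i * (cmod ((U\<^sup>\<dagger> *\<^sub>v v) $ i))\<^sup>2)"
  using qf_congruence_dg[of U n n v d] by (simp add: eigen_decomp_def unitary_def)

lemma qf_eigenvector:
  assumes X: "eigen_decomp n X U d" and i: "i < n"
  shows "qf X (col U i) = d i" "col U i \<in> carrier_vec n" "col U i \<noteq> 0\<^sub>v n"
proof -
  have U: "U \<in> carrier_mat n n" "U\<^sup>\<dagger> * U = 1\<^sub>m n" using X by (auto simp: eigen_decomp_def unitary_def)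
  have "U\<^sup>\<dagger> *\<^sub>v col U i = col (U\<^sup>\<dagger> * U) i" using i U(1) by (intro eq_vecI) auto
  then have c: "U\<^sup>\<dagger> *\<^sub>v col U i = unit_vec n i" using i U(2) by auto
  show v: "col U i \<in> carrier_vec n" using U by auto
  show "qf X (col U i) = d i"
    unfolding qf_eigen[OF X v] c using i
    by (simp add: unit_vec_def if_distrib[of cmod] if_distrib[of "\<lambda>x. x\<^sup>2"] if_distrib[of "\<lambda>x. _ * x"] sum.delta cong: if_cong)
  show "col U i \<noteq> 0\<^sub>v n"
  proof
    assume "col U i = 0\<^sub>v n"
    then have "unit_vec n i = (0\<^sub>v n :: complex vec)" using c mult_zero_vec[of "U\<^sup>\<dagger>" n n] U by simp
    then have "(unit_vec n i :: complex vec) $ i = 0\<^sub>v n $ i" by simp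
    then show False using i by simp
  qed
qed

lemma left_inverse_vec_eq_0:
  fixes v :: "complex vec"
  assumes "R * S = 1\<^sub>m m" "R \<in> carrier_mat m n" "S \<in> carrier_mat n m" "v \<in> carrier_vec m"
    and "S *\<^sub>v v = 0\<^sub>v n"
  shows "v = 0\<^sub>v m"
proof -
  have "v = (R * S) *\<^sub>v v" unfolding assms(1) using one_mult_mat_vec[OF assms(4)] by simp
  also have "\<dots> = R *\<^sub>v (S *\<^sub>v v)" by (rule assoc_mult_mat_vec[OF assms(2,3,4)])
  also have "\<dots> = 0\<^sub>v m" unfolding assms(5) by (rule mult_zero_vec[OF assms(2)])
  finally show ?thesis .
qed

lemma pd_iff_eigen:
  assumes X: "eigen_decomp n X U d"
  shows "pd n X \<longleftrightarrow> (\<forall>i<n. 0 < d i)"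
proof
  assume "pd n X"
  then show "\<forall>i<n. 0 < d i" using qf_eigenvector[OF X] unfolding pd_def by (metis (no_types))
next
  assume d: "\<forall>i<n. 0 < d i"
  have U: "U \<in> carrier_mat n n" "U * U\<^sup>\<dagger> = 1\<^sub>m n" using X by (auto simp: eigen_decomp_def unitary_def)
  have "0 < qf X v" if v: "v \<in> carrier_vec n" and v0: "v \<noteq> 0\<^sub>v n" for v
  proof -
    have "U\<^sup>\<dagger> *\<^sub>v v \<noteq> 0\<^sub>v n" using left_inverse_vec_eq_0[OF U(2) U(1) _ v] U v0 by blast
    then obtain i where i: "i < n" "(U\<^sup>\<dagger> *\<^sub>v v) $ i \<noteq> 0" using U v
      by (metis adj_carrier carrier_vecD eq_vecI index_zero_vec mult_mat_vec_carrier)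
    show ?thesis unfolding qf_eigen[OF X v]
      by (rule sum_pos2[of _ i]) (use i d in \<open>auto intro!: mult_nonneg_nonneg simp: less_imp_le\<close>)
  qed
  then show "pd n X" using eigen_decomp_carrier[OF X] eigen_decomp_hermitian[OF X]
    by (auto simp: pd_def)
qed

lemma pd_eigen_decomp:
  assumes "pd n X"
  obtains U d where "eigen_decomp n X U d" "mono_on {..<n} d" "\<And>i. i < n \<Longrightarrow> 0 < d i"
proof -
  obtain U d where X: "eigen_decomp n X U d" "mono_on {..<n} d"
    using assms hermitian_eigen_decomp[of X n] eigen_decomp_sort unfolding pd_def by blast
  then show ?thesis using that assms pd_iff_eigen[OF X(1)] by blast
qed

lemma psd_eigen_decomp:
  assumes "psd n X"
  obtains U d where "eigen_decomp n X U d" "mono_on {..<n} d" "\<And>i. i < n \<Longrightarrow> 0 \<le> d i"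
proof -
  obtain U d where X: "eigen_decomp n X U d" "mono_on {..<n} d"
    using assms hermitian_eigen_decomp[of X n] eigen_decomp_sort unfolding psd_def by blast
  moreover have "0 \<le> d i" if "i < n" for i
  proof -
    have "0 \<le> (X *\<^sub>v col U i) \<bullet>c col U i" using assms qf_eigenvector(2)[OF X(1) that] by (auto simp: psd_def)
    then show ?thesis using qf_eigenvector(1)[OF X(1) that] by (simp add: qf_def less_eq_complex_def)
  qed
  ultimately show ?thesis using that by blast
qed

lemma det_dg: "Determinant.det (dg n d) = of_real (\<Prod>i<n. d i)"
  by (subst det_upper_triangular[of _ n])
    (auto simp: mat_diag_def diag_mat_def prod.list_conv_set_nth atLeast0LessThan)

lemma det_eigen:
  assumes X: "eigen_decomp n X U d"
  shows "Determinant.det X = of_real (\<Prod>i<n. d i)"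
proof -
  have "similar_mat X (dg n d)"
    using X eigen_decomp_carrier[OF X] by (intro similar_matI[of _ _ U "U\<^sup>\<dagger>" n]) (auto simp: eigen_decomp_def unitary_def)
  then show ?thesis using det_similar det_dg by metis
qed

lemma invertible_iff_det:
  fixes A :: "complex mat"
  assumes "A \<in> carrier_mat n n"
  shows "invertible_mat A \<longleftrightarrow> Determinant.det A \<noteq> 0"
proof
  assume "invertible_mat A"
  then obtain B where "A * B = 1\<^sub>m n" "B * A = 1\<^sub>m (dim_row B)"
    using assms unfolding invertible_mat_def inverts_mat_def by auto
  moreover from this have "B \<in> carrier_mat n n"
  proof -
    have "dim_col (A * B) = n" "dim_col (B * A) = dim_row B"
      using \<open>A * B = 1\<^sub>m n\<close> \<open>B * A = 1\<^sub>m (dim_row B)\<close> by simp_all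
    then show ?thesis using assms by auto
  qed
  ultimately have "Determinant.det A * Determinant.det B = 1" using assms det_mult[of A n B] by simp
  then show "Determinant.det A \<noteq> 0" by auto
next
  assume "Determinant.det A \<noteq> 0"
  then obtain B where "B \<in> carrier_mat n n" "B * A = 1\<^sub>m n" "A * B = 1\<^sub>m n"
    using det_non_zero_imp_unit[OF assms] unfolding Units_def ring_mat_simps by auto
  then show "invertible_mat A" using assms unfolding invertible_mat_def inverts_mat_def by auto
qed

lemma pd_congruence:
  assumes M: "pd n M" and Z: "Z \<in> carrier_mat n k" and L: "L \<in> carrier_mat k n" "L * Z = 1\<^sub>m k"
  shows "pd k (Z\<^sup>\<dagger> * M * Z)"
proof -
  have Mc: "M \<in> carrier_mat n n" "M\<^sup>\<dagger> = M" using M by (auto simp: pd_def)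
  have "0 < qf (Z\<^sup>\<dagger> * M * Z) v" if v: "v \<in> carrier_vec k" "v \<noteq> 0\<^sub>v k" for v
  proof -
    have "Z *\<^sub>v v \<noteq> 0\<^sub>v n" using left_inverse_vec_eq_0[OF L(2) L(1) Z v(1)] v(2) by blast
    moreover have "qf (Z\<^sup>\<dagger> * M * Z) v = qf M (Z *\<^sub>v v)"
      using inner_congruence[of "Z\<^sup>\<dagger>" k n M v] Z Mc v by (simp add: qf_def)
    ultimately show ?thesis using M Z v by (auto simp: pd_def)
  qed
  then show ?thesis using hermitian_congruence[of "Z\<^sup>\<dagger>" k n M] Z Mc by (auto simp: pd_def)
qed

lemma pd_dg: "(\<And>i. i < n \<Longrightarrow> 0 < d i) \<Longrightarrow> pd n (dg n d)"
  using pd_iff_eigen[of n "dg n d" "1\<^sub>m n" d] by (simp add: eigen_decomp_def)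

section \<open>Simultaneous diagonalization by congruence\<close>

text \<open>Rescaling the eigenvectors of \<open>P\<close> turns \<open>P\<close> into the identity, and a further unitary change of basis
  diagonalizes what has become of \<open>Q\<close> without disturbing the identity.\<close>

lemma simultaneous_diagonalization:
  assumes P: "pd k P" and Q: "pd k Q"
  obtains T l where "T \<in> carrier_mat k k" "T\<^sup>\<dagger> * P * T = 1\<^sub>m k" "T\<^sup>\<dagger> * Q * T = dg k l"
    "\<And>i. i < k \<Longrightarrow> 0 < l i"
proof -
  obtain U p where PU: "eigen_decomp k P U p" and p: "\<And>i. i < k \<Longrightarrow> 0 < p i"
    using pd_eigen_decomp[OF P] by blast
  have U: "unitary k U" "U \<in> carrier_mat k k" "U\<^sup>\<dagger> * U = 1\<^sub>m k" and Peq: "P = U * dg k p * U\<^sup>\<dagger>"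
    using PU by (auto simp: eigen_decomp_def unitary_def)
  have Qc: "Q \<in> carrier_mat k k" "Q\<^sup>\<dagger> = Q" using Q by (auto simp: pd_def)
  define r where "r i = 1 / sqrt (p i)" for i
  define R where "R = U * dg k r"
  have R: "R \<in> carrier_mat k k" using U by (auto simp: R_def)
  have "R\<^sup>\<dagger> * P * R = dg k r * (dg k p * dg k r)"
    using U unitary_cancel[OF U(1)]
    by (simp add: R_def Peq adj_mult_dim mat_assoc del: mat_diag_diag)
  also have "\<dots> = 1\<^sub>m k"
    unfolding dg_dg
  proof (rule dg_eq_one)
    fix i assume i: "i < k"
    have "r i * (p i * r i) = p i / (sqrt (p i) * sqrt (p i))" by (simp add: r_def)
    then show "r i * (p i * r i) = 1" using p[OF i] by simp
  qed
  finally have RPR: "R\<^sup>\<dagger> * P * R = 1\<^sub>m k" .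
  have "(R\<^sup>\<dagger> * Q * R)\<^sup>\<dagger> = R\<^sup>\<dagger> * Q * R" using hermitian_congruence[of "R\<^sup>\<dagger>" k k Q] R Qc by simp
  then obtain V l where V: "eigen_decomp k (R\<^sup>\<dagger> * Q * R) V l"
    using hermitian_eigen_decomp[of "R\<^sup>\<dagger> * Q * R" k] R Qc by auto
  have Vu: "unitary k V" "V \<in> carrier_mat k k" "V\<^sup>\<dagger> * V = 1\<^sub>m k" and Veq: "R\<^sup>\<dagger> * Q * R = V * dg k l * V\<^sup>\<dagger>"
    using V by (auto simp: eigen_decomp_def unitary_def)
  define T where "T = R * V"
  have T: "T \<in> carrier_mat k k" using R Vu by (auto simp: T_def)
  have cong: "T\<^sup>\<dagger> * M * T = V\<^sup>\<dagger> * (R\<^sup>\<dagger> * M * R) * V" if "M \<in> carrier_mat k k" for M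
    using that R Vu by (simp add: T_def adj_mult_dim mat_assoc)
  have TPT: "T\<^sup>\<dagger> * P * T = 1\<^sub>m k" using cong[of P] RPR Vu P by (simp add: pd_def)
  have TQT: "T\<^sup>\<dagger> * Q * T = dg k l"
    using cong[of Q] Vu Qc unitary_cancel[OF Vu(1)] unitary_cancel_right[OF Vu(1)]
    by (simp add: Veq mat_assoc)
  have "pd k (T\<^sup>\<dagger> * Q * T)"
    by (rule pd_congruence[OF Q T _ TPT]) (use T P in \<open>auto simp: pd_def\<close>)
  then have "0 < l i" if "i < k" for i
    using that pd_iff_eigen[of k "dg k l" "1\<^sub>m k" l] by (simp add: TQT eigen_decomp_def)
  then show ?thesis using that T TPT TQT by blast
qed

text \<open>With \<open>S = A\<^sup>1\<^sup>/\<^sup>2 V\<close>, where \<open>V\<close> diagonalizes \<open>A\<^sup>-\<^sup>1\<^sup>/\<^sup>2 B A\<^sup>-\<^sup>1\<^sup>/\<^sup>2\<close>, the mean becomes a function of the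
  diagonal entries \<open>e\<close>. The same \<open>S\<close> and \<open>e\<close> serve all functions \<open>h\<close>, so that the
  weighted geometric means can be compared with their average.\<close>

lemma inv_mean_congruence:
  assumes A: "pd n A" and B: "pd n B"
  obtains S R e where "S \<in> carrier_mat n n" "R \<in> carrier_mat n n" "S * R = 1\<^sub>m n" "R * S = 1\<^sub>m n"
    "\<And>i. i < n \<Longrightarrow> 0 < e i" "A = S * dg n (\<lambda>_. 1) * S\<^sup>\<dagger>" "B = S * dg n e * S\<^sup>\<dagger>"
    "\<And>h. inv_mean h A B = S * dg n (\<lambda>i. h (e i)) * S\<^sup>\<dagger>"
proof -
  obtain U a where AU: "eigen_decomp n A U a" and a: "\<And>i. i < n \<Longrightarrow> 0 < a i"
    using pd_eigen_decomp[OF A] by blast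
  have U: "unitary n U" "U \<in> carrier_mat n n" "U\<^sup>\<dagger> * U = 1\<^sub>m n" "U * U\<^sup>\<dagger> = 1\<^sub>m n" and Aeq: "A = U * dg n a * U\<^sup>\<dagger>"
    using AU by (auto simp: eigen_decomp_def unitary_def)
  have Bc: "B \<in> carrier_mat n n" "B\<^sup>\<dagger> = B" using B by (auto simp: pd_def)
  define H where "H = fun_calc sqrt A"
  define K where "K = fun_calc (\<lambda>x. x powr (-1/2)) A"
  have Heq: "H = U * dg n (\<lambda>i. sqrt (a i)) * U\<^sup>\<dagger>" and Keq: "K = U * dg n (\<lambda>i. a i powr (-1/2)) * U\<^sup>\<dagger>"
    unfolding H_def K_def by (rule fun_calc_eq[OF AU])+
  have H: "H \<in> carrier_mat n n" "H\<^sup>\<dagger> = H" and K: "K \<in> carrier_mat n n" "K\<^sup>\<dagger> = K"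
    using U hermitian_congruence[OF U(2)] by (auto simp: Heq Keq)
  have pw: "x powr (-1/2) = 1 / sqrt x" if "x > 0" for x :: real
    using that by (simp add: powr_minus_divide powr_half_sqrt)
  have dHK: "dg n (\<lambda>i. sqrt (a i)) * dg n (\<lambda>i. a i powr (-1/2)) = 1\<^sub>m n"
       "dg n (\<lambda>i. a i powr (-1/2)) * dg n (\<lambda>i. sqrt (a i)) = 1\<^sub>m n"
  proof -
    have 1: "sqrt (a i) * a i powr (-1/2) = 1" if "i < n" for i
      using a[OF that] pw[OF a[OF that]] by simp
    show "dg n (\<lambda>i. sqrt (a i)) * dg n (\<lambda>i. a i powr (-1/2)) = 1\<^sub>m n"
      unfolding dg_dg by (rule dg_eq_one[OF 1])
    then show "dg n (\<lambda>i. a i powr (-1/2)) * dg n (\<lambda>i. sqrt (a i)) = 1\<^sub>m n"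
      by (simp add: mult.commute)
  qed
  have HK: "H * K = 1\<^sub>m n" "K * H = 1\<^sub>m n" and HH: "H * H = A"
  proof -
    have mul: "(U * dg n f * U\<^sup>\<dagger>) * (U * dg n g * U\<^sup>\<dagger>) = U * (dg n f * dg n g) * U\<^sup>\<dagger>" for f g
      using U unitary_cancel[OF U(1)] by (simp add: mat_assoc del: mat_diag_diag)
    show "H * K = 1\<^sub>m n" "K * H = 1\<^sub>m n" unfolding Heq Keq mul dHK using U by auto
    have "dg n (\<lambda>i. sqrt (a i)) * dg n (\<lambda>i. sqrt (a i)) = dg n a"
      unfolding dg_dg by (rule dg_cong) (use a in \<open>auto simp: less_imp_le\<close>)
    then show "H * H = A" unfolding Heq mul Aeq by simp
  qed
  define M where "M = K * B * K"
  have Mpd: "pd n M" using pd_congruence[OF B K(1) H(1) HK(1)] K by (simp add: M_def)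
  obtain V e where MV: "eigen_decomp n M V e" and e: "\<And>i. i < n \<Longrightarrow> 0 < e i"
    using pd_eigen_decomp[OF Mpd] by blast
  have V: "unitary n V" "V \<in> carrier_mat n n" "V\<^sup>\<dagger> * V = 1\<^sub>m n" and Meq: "M = V * dg n e * V\<^sup>\<dagger>"
    using MV by (auto simp: eigen_decomp_def unitary_def)
  define S where "S = H * V"
  define R where "R = V\<^sup>\<dagger> * K"
  have SR: "S \<in> carrier_mat n n" "R \<in> carrier_mat n n" using H K V by (auto simp: S_def R_def)
  have S_cong: "S * D * S\<^sup>\<dagger> = H * (V * D * V\<^sup>\<dagger>) * H" if "D \<in> carrier_mat n n" for D
    using that V H by (simp add: S_def adj_mult_dim mat_assoc)
  have "S * R = H * (V * (V\<^sup>\<dagger> * K))" unfolding S_def R_def using H K V by (simp add: mat_assoc)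
  then have 1: "S * R = 1\<^sub>m n" using unitary_cancel[OF V(1), of K] K HK by simp
  have 2: "R * S = 1\<^sub>m n" using mat_mult_left_right_inverse[OF SR 1] .
  have 3: "A = S * dg n (\<lambda>_. 1) * S\<^sup>\<dagger>"
    using S_cong[of "1\<^sub>m n"] V H HH by (simp add: unitary_def)
  have "S * dg n e * S\<^sup>\<dagger> = H * M * H" using S_cong[of "dg n e"] by (simp add: Meq)
  also have "\<dots> = (H * K) * B * (K * H)" using H K Bc by (simp add: M_def mat_assoc del: HK)
  also have "\<dots> = B" using HK Bc by simp
  finally have 4: "B = S * dg n e * S\<^sup>\<dagger>" by simp
  have 5: "inv_mean h A B = S * dg n (\<lambda>i. h (e i)) * S\<^sup>\<dagger>" for h
    using S_cong[of "dg n (\<lambda>i. h (e i))"] fun_calc_eq[OF MV, of h]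
    by (simp add: inv_mean_def M_def H_def K_def)
  show ?thesis using that[OF SR 1 2 e 3 4 5] .
qed

section \<open>Products of the smallest eigenvalues\<close>

lemma powr_le_affine:
  fixes y a :: real
  assumes "y > 0" "0 \<le> a" "a \<le> 1"
  shows "y powr a \<le> a * y + (1 - a)"
  using convex_onD[OF exp_convex, of a 0 "ln y"] assms by (simp add: powr_def)

text \<open>Jensen's inequality for the concave function \<open>x\<^sup>a\<close>: after division by the mean \<open>m\<close> of the \<open>x\<^sub>i\<close> it is
  the tangent line at 1, averaged.\<close>

lemma sum_powr_le_powr_sum:
  fixes w x :: "nat \<Rightarrow> real"
  assumes w: "\<And>i. i < n \<Longrightarrow> 0 \<le> w i" "(\<Sum>i<n. w i) = 1" and x: "\<And>i. i < n \<Longrightarrow> 0 < x i"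
    and a: "0 \<le> a" "a \<le> 1"
  shows "(\<Sum>i<n. w i * x i powr a) \<le> (\<Sum>i<n. w i * x i) powr a"
proof -
  define m where "m = (\<Sum>i<n. w i * x i)"
  obtain i where i: "i < n" "w i \<noteq> 0" using w(2) by (metis lessThan_iff sum.neutral zero_neq_one)
  then have "w i > 0" using w(1)[of i] by simp
  then have m: "m > 0" unfolding m_def
    by (intro sum_pos2[of _ i]) (use i w x in \<open>auto intro!: mult_nonneg_nonneg simp: less_imp_le\<close>)
  have "(\<Sum>i<n. w i * x i powr a) = m powr a * (\<Sum>i<n. w i * (x i / m) powr a)"
    using m x by (auto simp: sum_distrib_left powr_divide less_imp_le intro!: sum.cong)
  also have "\<dots> \<le> m powr a * (\<Sum>i<n. w i * (a * (x i / m) + (1 - a)))"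
    using m x w a by (intro mult_left_mono sum_mono powr_le_affine) auto
  also have "(\<Sum>i<n. w i * (a * (x i / m) + (1 - a))) = a * (m / m) + (1 - a) * (\<Sum>i<n. w i)"
  proof -
    have "(\<Sum>i<n. w i * (a * (x i / m) + (1 - a))) = (\<Sum>i<n. a / m * (w i * x i) + (1 - a) * w i)"
      by (intro sum.cong) (auto simp: algebra_simps)
    also have "\<dots> = a / m * m + (1 - a) * (\<Sum>i<n. w i)"
      unfolding sum.distrib sum_distrib_left[symmetric] m_def ..
    finally show ?thesis by simp
  qed
  also have "\<dots> = 1" using m w by simp
  finally show ?thesis by (simp add: m_def)
qed

text \<open>Weights in \<open>[0, 1]\<close> of total mass \<open>k\<close> give the smallest sum if they are 1 on the \<open>k\<close> smallest
  values. Comparing with the threshold \<open>l (k - 1)\<close>, moving mass away from these values never decreases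
  the sum.\<close>

lemma sum_smallest_le_weighted_sum:
  fixes l p :: "nat \<Rightarrow> real"
  assumes l: "mono_on {..<n} l" and p: "\<And>i. i < n \<Longrightarrow> 0 \<le> p i" "\<And>i. i < n \<Longrightarrow> p i \<le> 1"
    and sum: "(\<Sum>i<n. p i) = real k" and k: "k \<le> n"
  shows "(\<Sum>i<k. l i) \<le> (\<Sum>i<n. p i * l i)"
proof (cases "k = 0")
  case True
  then have "p i = 0" if "i < n" for i
    using sum p that sum_nonneg_eq_0_iff[of "{..<n}" p] by auto
  then show ?thesis using True by simp
next
  case False
  define c where "c = l (k - 1)"
  define q :: "nat \<Rightarrow> real" where "q i = (if i < k then 1 else 0)" for i
  have restrict: "(\<Sum>i<n. q i * g i) = (\<Sum>i<k. g i)" for g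
  proof -
    have "(\<Sum>i<n. q i * g i) = (\<Sum>i\<in>{..<n} \<inter> {i. i < k}. g i)"
      by (simp add: q_def sum.inter_restrict if_distrib[of "\<lambda>x. x * _"] cong: if_cong)
    also have "{..<n} \<inter> {i. i < k} = {..<k}" using k by auto
    finally show ?thesis .
  qed
  have "0 \<le> (\<Sum>i<n. (p i - q i) * (l i - c))"
  proof (rule sum_nonneg)
    fix i assume i: "i \<in> {..<n}"
    show "0 \<le> (p i - q i) * (l i - c)"
    proof (cases "i < k")
      case True
      then have "l i \<le> c" unfolding c_def using mono_onD[OF l, of i "k - 1"] False k i by auto
      then show ?thesis using p(2)[of i] i True by (auto simp: q_def intro!: mult_nonpos_nonpos)
    next
      case F: False
      then have "c \<le> l i" unfolding c_def using mono_onD[OF l, of "k - 1" i] False k i by auto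
      then show ?thesis using p(1)[of i] i F by (auto simp: q_def)
    qed
  qed
  also have "\<dots> = (\<Sum>i<n. p i * l i) - (\<Sum>i<n. q i * l i) - c * ((\<Sum>i<n. p i) - (\<Sum>i<n. q i * 1))"
    by (simp add: algebra_simps sum_subtractf sum.distrib sum_distrib_left)
  also have "\<dots> = (\<Sum>i<n. p i * l i) - (\<Sum>i<k. l i)"
    unfolding restrict using sum by simp
  finally show ?thesis by simp
qed

lemma diag_congruence_dg:
  assumes "Z \<in> carrier_mat n k" "j < k"
  shows "(Z\<^sup>\<dagger> * dg n d * Z) $$ (j, j) = of_real (\<Sum>i<n. (cmod (Z $$ (i, j)))\<^sup>2 * d i)"
proof -
  have "(Z\<^sup>\<dagger> * dg n d * Z) $$ (j, j) = (\<Sum>i<n. (Z $$ (i, j) * cnj (Z $$ (i, j))) * of_real (d i))"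
    using index_congruence_dg'[OF assms assms(2)] by (simp add: ac_simps)
  then show ?thesis by (simp only: of_real_sum of_real_mult complex_norm_square)
qed

text \<open>The \<open>j\<close>-th diagonal entry is an average of the \<open>d\<^sub>i\<close> with weights \<open>\<bar>Z\<^sub>i\<^sub>j\<bar>\<^sup>2\<close>, hence at least the
  corresponding weighted geometric mean. In the product over \<open>j\<close> the exponent of \<open>d\<^sub>i\<close> is the row sum
  \<open>p\<^sub>i\<close>. These exponents add up to \<open>k\<close>, and they are at most 1 because \<open>p\<^sub>i\<close> is a diagonal entry of the
  projection \<open>Z Z\<^sup>*\<close>.\<close>

lemma prod_diag_ge_prod_smallest:
  assumes Z: "Z \<in> carrier_mat n k" "Z\<^sup>\<dagger> * Z = 1\<^sub>m k" and k: "k \<le> n"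
    and d: "mono_on {..<n} d" "\<And>i. i < n \<Longrightarrow> 0 < d i"
  shows "(\<Prod>i<k. d i) \<le> (\<Prod>j<k. Re ((Z\<^sup>\<dagger> * dg n d * Z) $$ (j, j)))"
proof -
  define w where "w i j = (cmod (Z $$ (i, j)))\<^sup>2" for i j
  define l where "l i = ln (d i)" for i
  define p where "p i = (\<Sum>j<k. w i j)" for i
  have w0: "0 \<le> w i j" for i j by (simp add: w_def)
  have w1: "(\<Sum>i<n. w i j) = 1" if "j < k" for j
  proof -
    have "Z\<^sup>\<dagger> * dg n (\<lambda>_. 1) * Z = 1\<^sub>m k" using Z by (simp add: mat_assoc)
    then have "complex_of_real (\<Sum>i<n. w i j) = 1"
      using diag_congruence_dg[OF Z(1) that, of "\<lambda>_. 1"] that by (simp add: w_def)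
    then show ?thesis using of_real_eq_1_iff by blast
  qed
  have p1: "p i \<le> 1" if i: "i < n" for i
  proof -
    define G where "G = Z * Z\<^sup>\<dagger>"
    have G: "G \<in> carrier_mat n n" "G\<^sup>\<dagger> = G" using Z by (auto simp: G_def adj_mult_dim)
    have "G * G = Z * (Z\<^sup>\<dagger> * Z) * Z\<^sup>\<dagger>" using Z(1) by (simp add: G_def mat_assoc)
    then have GG: "G\<^sup>\<dagger> * dg n (\<lambda>_. 1) * G = G" using Z G by (simp add: G_def)
    have Gii: "G $$ (i, i) = of_real (p i)"
    proof -
      have "G = (Z\<^sup>\<dagger>)\<^sup>\<dagger> * dg k (\<lambda>_. 1) * Z\<^sup>\<dagger>" using Z by (simp add: G_def)
      then show ?thesis using diag_congruence_dg[of "Z\<^sup>\<dagger>" k n i "\<lambda>_. 1"] Z i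
        by (simp add: p_def w_def)
    qed
    have "complex_of_real (p i) = of_real (\<Sum>q<n. (cmod (G $$ (q, i)))\<^sup>2 * 1)"
      using diag_congruence_dg[OF G(1) i, of "\<lambda>_. 1"] unfolding GG Gii .
    then have "p i = (\<Sum>q<n. (cmod (G $$ (q, i)))\<^sup>2)" by (simp only: of_real_eq_iff mult_1_right)
    also have "\<dots> \<ge> (cmod (G $$ (i, i)))\<^sup>2"
      using i member_le_sum[of i "{..<n}" "\<lambda>q. (cmod (G $$ (q, i)))\<^sup>2"] by auto
    finally have "(p i)\<^sup>2 \<le> p i" by (simp add: Gii)
    then show ?thesis
      by (cases "p i > 0") (auto simp: power2_eq_square)
  qed
  have "(\<Sum>i<n. p i) = (\<Sum>j<k. \<Sum>i<n. w i j)" unfolding p_def by (rule sum.swap)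
  then have psum: "(\<Sum>i<n. p i) = real k" using w1 by simp
  have lmono: "mono_on {..<n} l"
    using d by (auto simp: mono_on_def l_def)
  have "(\<Prod>i<k. d i) = exp (\<Sum>i<k. l i)"
    using d k by (auto simp: exp_sum l_def intro!: prod.cong)
  also have "\<dots> \<le> exp (\<Sum>i<n. p i * l i)"
    using sum_smallest_le_weighted_sum[OF lmono _ p1 psum k] w0
    by (simp add: p_def sum_nonneg)
  also have "(\<Sum>i<n. p i * l i) = (\<Sum>j<k. \<Sum>i<n. w i j * l i)"
    unfolding p_def sum_distrib_right by (rule sum.swap)
  also have "exp \<dots> = (\<Prod>j<k. exp (\<Sum>i<n. w i j * l i))"
    by (simp add: exp_sum)
  also have "\<dots> \<le> (\<Prod>j<k. \<Sum>i<n. w i j * d i)"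
  proof (rule prod_mono, intro conjI)
    fix j assume j: "j \<in> {..<k}"
    then have "0 \<in> {..<n}" using k by auto
    then have "{..<n} \<noteq> {}" by blast
    then have "exp (\<Sum>i<n. w i j *\<^sub>R l i) \<le> (\<Sum>i<n. w i j * exp (l i))"
      using j w0 w1 by (intro convex_on_sum[OF _ _ exp_convex]) auto
    also have "\<dots> = (\<Sum>i<n. w i j * d i)" using d(2) by (simp add: l_def)
    finally show "exp (\<Sum>i<n. w i j * l i) \<le> (\<Sum>i<n. w i j * d i)" by simp
  qed simp
  also have "\<dots> = (\<Prod>j<k. Re ((Z\<^sup>\<dagger> * dg n d * Z) $$ (j, j)))"
    by (intro prod.cong refl) (subst diag_congruence_dg[OF Z(1)], auto simp: w_def)
  finally show ?thesis .
qed

lemma Re_det_dg: "Re (Determinant.det (dg n d)) = (\<Prod>i<n. d i)"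
  unfolding det_dg by (rule Re_complex_of_real)

lemma Re_det_eigen: "eigen_decomp n X U d \<Longrightarrow> Re (Determinant.det X) = (\<Prod>i<n. d i)"
  using det_eigen by (metis Re_complex_of_real)

lemma det_pd:
  assumes "pd k M"
  shows "Determinant.det M = of_real (Re (Determinant.det M))" "0 < Re (Determinant.det M)"
proof -
  obtain U d where d: "eigen_decomp k M U d" "\<And>i. i < k \<Longrightarrow> 0 < d i"
    using pd_eigen_decomp[OF assms] by blast
  show "0 < Re (Determinant.det M)"
    unfolding Re_det_eigen[OF d(1)] using d(2) by (auto intro: prod_pos)
  show "Determinant.det M = of_real (Re (Determinant.det M))"
    unfolding Re_det_eigen[OF d(1)] by (rule det_eigen[OF d(1)])
qed

text \<open>For \<open>k = n\<close> the product of the smallest eigenvalues is the determinant, and the previous bound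
  becomes Hadamard's inequality.\<close>

lemma Hadamard_inequality:
  assumes M: "pd k M"
  shows "Re (Determinant.det M) \<le> (\<Prod>j<k. Re (M $$ (j, j)))"
proof -
  obtain U d where d: "eigen_decomp k M U d" "mono_on {..<k} d" "\<And>i. i < k \<Longrightarrow> 0 < d i"
    using pd_eigen_decomp[OF M] by blast
  from d(1) have U: "U \<in> carrier_mat k k" "U * U\<^sup>\<dagger> = 1\<^sub>m k" "M = U * dg k d * U\<^sup>\<dagger>"
    by (auto simp: eigen_decomp_def unitary_def)
  have "(\<Prod>i<k. d i) \<le> (\<Prod>j<k. Re (((U\<^sup>\<dagger>)\<^sup>\<dagger> * dg k d * U\<^sup>\<dagger>) $$ (j, j)))"
    by (rule prod_diag_ge_prod_smallest) (use U d in auto)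
  then show ?thesis unfolding Re_det_eigen[OF d(1)] adj_adj U(3)[symmetric] .
qed

section \<open>Determinants of compressions\<close>

lemma det_normalizing_congruence:
  assumes "T \<in> carrier_mat k k" "P \<in> carrier_mat k k" "M \<in> carrier_mat k k" "T\<^sup>\<dagger> * P * T = 1\<^sub>m k"
  shows "Determinant.det (T\<^sup>\<dagger> * M * T) * Determinant.det P = Determinant.det M"
proof -
  have *: "Determinant.det (T\<^sup>\<dagger> * X * T) = Determinant.det T\<^sup>\<dagger> * Determinant.det X * Determinant.det T"
    if "X \<in> carrier_mat k k" for X
    using that assms(1) by (simp add: det_mult[of _ k])
  have "Determinant.det T\<^sup>\<dagger> * Determinant.det P * Determinant.det T = 1"
    using *[OF assms(2)] assms(4) by simp
  moreover have "Determinant.det (T\<^sup>\<dagger> * M * T) * Determinant.det P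
      = Determinant.det M * (Determinant.det T\<^sup>\<dagger> * Determinant.det P * Determinant.det T)"
    unfolding *[OF assms(3)] by simp
  ultimately show ?thesis by simp
qed

text \<open>Within the column span of \<open>Y\<close> one can choose a basis \<open>Z\<close> that is orthonormal and diagonalizes the
  compression of \<open>diag(f)\<close>. The change of basis multiplies the determinants of all compressions by the same
  factor \<open>det (Y\<^sup>* Y)\<close>, so that determinant inequalities need only be proved for \<open>Z\<close>.\<close>

lemma compression_frame:
  assumes Y: "Y \<in> carrier_mat n k" and L: "L \<in> carrier_mat k n" "L * Y = 1\<^sub>m k"
    and f: "\<And>i. i < n \<Longrightarrow> 0 < f i"
  obtains Z l where "Z \<in> carrier_mat n k" "Z\<^sup>\<dagger> * Z = 1\<^sub>m k" "Z\<^sup>\<dagger> * dg n f * Z = dg k l"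
    "\<And>j. j < k \<Longrightarrow> 0 < l j"
    "\<And>g. (\<And>i. i < n \<Longrightarrow> 0 < g i) \<Longrightarrow> pd k (Z\<^sup>\<dagger> * dg n g * Z) \<and>
       Re (Determinant.det (Y\<^sup>\<dagger> * dg n g * Y)) =
       Re (Determinant.det (Z\<^sup>\<dagger> * dg n g * Z)) * Re (Determinant.det (Y\<^sup>\<dagger> * Y))"
proof -
  have pdY: "pd k (Y\<^sup>\<dagger> * dg n g * Y)" if "\<And>i. i < n \<Longrightarrow> 0 < g i" for g
    by (rule pd_congruence[OF pd_dg Y L]) (use that in auto)
  have "Y\<^sup>\<dagger> * dg n (\<lambda>_. 1) * Y = Y\<^sup>\<dagger> * Y" using Y by simp
  then have P: "pd k (Y\<^sup>\<dagger> * Y)" using pdY[of "\<lambda>_. 1"] by simp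
  obtain T l where T: "T \<in> carrier_mat k k" "T\<^sup>\<dagger> * (Y\<^sup>\<dagger> * Y) * T = 1\<^sub>m k"
    "T\<^sup>\<dagger> * (Y\<^sup>\<dagger> * dg n f * Y) * T = dg k l" and l: "\<And>j. j < k \<Longrightarrow> 0 < l j"
    using simultaneous_diagonalization[OF P pdY[of f, OF f]] by blast
  define Z where "Z = Y * T"
  have Z: "Z \<in> carrier_mat n k" using Y T by (simp add: Z_def)
  have ZZ: "Z\<^sup>\<dagger> * Z = 1\<^sub>m k" using T Y by (simp add: Z_def adj_mult_dim mat_assoc)
  have Zc: "Z\<^sup>\<dagger> * dg n g * Z = T\<^sup>\<dagger> * (Y\<^sup>\<dagger> * dg n g * Y) * T" for g
    using T Y by (simp add: Z_def adj_mult_dim mat_assoc)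
  have "pd k (Z\<^sup>\<dagger> * dg n g * Z) \<and>
       Re (Determinant.det (Y\<^sup>\<dagger> * dg n g * Y)) =
       Re (Determinant.det (Z\<^sup>\<dagger> * dg n g * Z)) * Re (Determinant.det (Y\<^sup>\<dagger> * Y))"
    if g: "\<And>i. i < n \<Longrightarrow> 0 < g i" for g
  proof
    show pdZ: "pd k (Z\<^sup>\<dagger> * dg n g * Z)"
      by (rule pd_congruence[OF pd_dg Z _ ZZ]) (use g Z in auto)
    have "Determinant.det (Z\<^sup>\<dagger> * dg n g * Z) * Determinant.det (Y\<^sup>\<dagger> * Y) = Determinant.det (Y\<^sup>\<dagger> * dg n g * Y)"
      unfolding Zc by (rule det_normalizing_congruence) (use T Y in auto)
    then show "Re (Determinant.det (Y\<^sup>\<dagger> * dg n g * Y)) =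
       Re (Determinant.det (Z\<^sup>\<dagger> * dg n g * Z)) * Re (Determinant.det (Y\<^sup>\<dagger> * Y))"
      by (subst (asm) det_pd(1)[OF pdZ], subst (asm) det_pd(1)[OF P]) (metis Re_complex_of_real of_real_mult)
  qed
  moreover have "Z\<^sup>\<dagger> * dg n f * Z = dg k l" unfolding Zc T(3) ..
  ultimately show ?thesis using that[of Z l] Z ZZ l by blast
qed

text \<open>In an orthonormal frame that diagonalizes the compression of \<open>diag(d)\<close>, its determinant is the
  product of its diagonal entries, to which the bound by the smallest eigenvalues applies.\<close>

lemma det_compression_ge:
  assumes Y: "Y \<in> carrier_mat n k" and L: "L \<in> carrier_mat k n" "L * Y = 1\<^sub>m k" and k: "k \<le> n"
    and d: "mono_on {..<n} d" "\<And>i. i < n \<Longrightarrow> 0 < d i"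
  shows "(\<Prod>i<k. d i) * Re (Determinant.det (Y\<^sup>\<dagger> * Y)) \<le> Re (Determinant.det (Y\<^sup>\<dagger> * dg n d * Y))"
proof -
  obtain Z l where Z: "Z \<in> carrier_mat n k" "Z\<^sup>\<dagger> * Z = 1\<^sub>m k" "Z\<^sup>\<dagger> * dg n d * Z = dg k l"
    and det: "Re (Determinant.det (Y\<^sup>\<dagger> * dg n d * Y)) =
       Re (Determinant.det (Z\<^sup>\<dagger> * dg n d * Z)) * Re (Determinant.det (Y\<^sup>\<dagger> * Y))"
    by (rule compression_frame[OF Y L d(2)]) (use d(2) in blast)+
  have "(\<Prod>i<k. d i) \<le> (\<Prod>j<k. Re ((Z\<^sup>\<dagger> * dg n d * Z) $$ (j, j)))"
    by (rule prod_diag_ge_prod_smallest[OF Z(1,2) k d])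
  also have "\<dots> = (\<Prod>j<k. l j)" unfolding Z(3) by (intro prod.cong) (auto simp: mat_diag_def)
  also have "\<dots> = Re (Determinant.det (Z\<^sup>\<dagger> * dg n d * Z))" unfolding Z(3) Re_det_dg ..
  finally have *: "(\<Prod>i<k. d i) \<le> Re (Determinant.det (Z\<^sup>\<dagger> * dg n d * Z))" .
  have "pd k (Y\<^sup>\<dagger> * dg n (\<lambda>_. 1) * Y)" by (rule pd_congruence[OF pd_dg Y L]) auto
  then have "0 < Re (Determinant.det (Y\<^sup>\<dagger> * Y))" using det_pd(2) Y by simp
  then show ?thesis unfolding det using * by (intro mult_right_mono) auto
qed

text \<open>This is the log-convexity in \<open>a\<close> of the determinant of the compression of \<open>diag(f\<^sup>a)\<close>. In a frame where
  the compressions for \<open>a = 0\<close> and \<open>a = 1\<close> are diagonal, Hadamard's inequality reduces it to the diagonal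
  entries, and there it is Jensen's inequality with the weights \<open>\<bar>Z\<^sub>i\<^sub>j\<bar>\<^sup>2\<close>.\<close>

lemma det_compression_powr_le:
  assumes Y: "Y \<in> carrier_mat n k" and L: "L \<in> carrier_mat k n" "L * Y = 1\<^sub>m k"
    and f: "\<And>i. i < n \<Longrightarrow> 0 < f i" and a: "0 \<le> a" "a \<le> 1"
  shows "Re (Determinant.det (Y\<^sup>\<dagger> * dg n (\<lambda>i. f i powr a) * Y))
    \<le> Re (Determinant.det (Y\<^sup>\<dagger> * Y)) powr (1 - a) * Re (Determinant.det (Y\<^sup>\<dagger> * dg n f * Y)) powr a"
proof -
  obtain Z l where Z: "Z \<in> carrier_mat n k" "Z\<^sup>\<dagger> * Z = 1\<^sub>m k" "Z\<^sup>\<dagger> * dg n f * Z = dg k l"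
    and l: "\<And>j. j < k \<Longrightarrow> 0 < l j"
    and det: "\<And>g. (\<And>i. i < n \<Longrightarrow> 0 < g i) \<Longrightarrow> pd k (Z\<^sup>\<dagger> * dg n g * Z) \<and>
       Re (Determinant.det (Y\<^sup>\<dagger> * dg n g * Y)) =
       Re (Determinant.det (Z\<^sup>\<dagger> * dg n g * Z)) * Re (Determinant.det (Y\<^sup>\<dagger> * Y))"
    by (rule compression_frame[OF Y L f]) blast+
  let ?fa = "\<lambda>i. f i powr a"
  define p where "p = Re (Determinant.det (Y\<^sup>\<dagger> * Y))"
  have "pd k (Y\<^sup>\<dagger> * dg n (\<lambda>_. 1) * Y)" by (rule pd_congruence[OF pd_dg Y L]) auto
  then have p: "0 < p" using det_pd(2) Y by (simp add: p_def)
  have fa: "0 < ?fa i" if "i < n" for i using f[OF that] by simp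
  have w1: "(\<Sum>i<n. (cmod (Z $$ (i, j)))\<^sup>2) = 1" if "j < k" for j
  proof -
    have "Z\<^sup>\<dagger> * dg n (\<lambda>_. 1) * Z = 1\<^sub>m k" using Z by (simp add: mat_assoc)
    then have "complex_of_real (\<Sum>i<n. (cmod (Z $$ (i, j)))\<^sup>2) = 1"
      using diag_congruence_dg[OF Z(1) that, of "\<lambda>_. 1"] that by simp
    then show ?thesis using of_real_eq_1_iff by blast
  qed
  have wl: "(\<Sum>i<n. (cmod (Z $$ (i, j)))\<^sup>2 * f i) = l j" if "j < k" for j
  proof -
    have "complex_of_real (\<Sum>i<n. (cmod (Z $$ (i, j)))\<^sup>2 * f i) = of_real (l j)"
      using diag_congruence_dg[OF Z(1) that, of f] that unfolding Z(3) by (simp add: mat_diag_def)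
    then show ?thesis using of_real_eq_iff by blast
  qed
  have "Re (Determinant.det (Z\<^sup>\<dagger> * dg n ?fa * Z)) \<le> (\<Prod>j<k. Re ((Z\<^sup>\<dagger> * dg n ?fa * Z) $$ (j, j)))"
    using Hadamard_inequality det[of ?fa, OF fa] by blast
  also have "\<dots> \<le> (\<Prod>j<k. l j powr a)"
  proof (rule prod_mono, intro conjI)
    fix j assume "j \<in> {..<k}"
    then have j: "j < k" by simp
    have e: "Re ((Z\<^sup>\<dagger> * dg n ?fa * Z) $$ (j, j)) = (\<Sum>i<n. (cmod (Z $$ (i, j)))\<^sup>2 * ?fa i)"
      unfolding diag_congruence_dg[OF Z(1) j] by simp
    show "0 \<le> Re ((Z\<^sup>\<dagger> * dg n ?fa * Z) $$ (j, j))" unfolding e by (intro sum_nonneg) auto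
    show "Re ((Z\<^sup>\<dagger> * dg n ?fa * Z) $$ (j, j)) \<le> l j powr a"
      unfolding e wl[OF j, symmetric]
      by (rule sum_powr_le_powr_sum) (use w1[OF j] f a in auto)
  qed
  also have "\<dots> = (\<Prod>j<k. l j) powr a" using l by (simp add: prod_powr_distrib less_imp_le)
  also have "(\<Prod>j<k. l j) = Re (Determinant.det (Z\<^sup>\<dagger> * dg n f * Z))" unfolding Z(3) Re_det_dg ..
  also have "\<dots> = Re (Determinant.det (Y\<^sup>\<dagger> * dg n f * Y)) / p"
    using det[of f, OF f] p by (simp add: p_def)
  finally have "Re (Determinant.det (Z\<^sup>\<dagger> * dg n ?fa * Z)) * p
      \<le> (Re (Determinant.det (Y\<^sup>\<dagger> * dg n f * Y)) / p) powr a * p"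
    using p by (intro mult_right_mono) auto
  also have "\<dots> = p powr (1 - a) * Re (Determinant.det (Y\<^sup>\<dagger> * dg n f * Y)) powr a"
  proof -
    have "0 \<le> Re (Determinant.det (Y\<^sup>\<dagger> * dg n f * Y))"
      using det_pd(2) pd_congruence[OF pd_dg Y L, of f] f by (simp add: less_imp_le)
    then show ?thesis using p by (simp add: powr_divide powr_diff)
  qed
  finally show ?thesis using det[of ?fa, OF fa] by (simp add: p_def)
qed

section \<open>Weighted geometric means\<close>

text \<open>Multiplication by this matrix on the right selects the first \<open>k\<close> columns.\<close>

definition coord_frame :: "nat \<Rightarrow> nat \<Rightarrow> complex mat" where
  "coord_frame n k = Matrix.mat n k (\<lambda>(i, j). if i = j then 1 else 0)"

lemma coord_frame_carrier [simp]: "coord_frame n k \<in> carrier_mat n k"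
  "dim_row (coord_frame n k) = n" "dim_col (coord_frame n k) = k"
  by (simp_all add: coord_frame_def)

lemma mult_coord_frame:
  assumes M: "M \<in> carrier_mat m n" and "k \<le> n" "i < m" "j < k"
  shows "(M * coord_frame n k) $$ (i, j) = M $$ (i, j)"
  using assms by (subst index_mult_sum[OF M coord_frame_carrier(1)])
    (auto simp: coord_frame_def if_distrib[of "\<lambda>x. _ * x"] sum.delta cong: if_cong)

lemma coord_frame_dg:
  assumes k: "k \<le> n"
  shows "(coord_frame n k)\<^sup>\<dagger> * dg n d * coord_frame n k = dg k d"
proof (rule eq_matI)
  fix i j assume "i < dim_row (dg k d)" "j < dim_col (dg k d)"
  then have ij: "i < k" "j < k" by auto
  have "((coord_frame n k)\<^sup>\<dagger> * dg n d * coord_frame n k) $$ (i, j) = ((coord_frame n k)\<^sup>\<dagger> * dg n d) $$ (i, j)"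
    by (rule mult_coord_frame) (use k ij in auto)
  also have "\<dots> = dg k d $$ (i, j)"
    using k ij by (subst mat_diag_mult_right[of _ k]) (auto simp: coord_frame_def mat_diag_def)
  finally show "((coord_frame n k)\<^sup>\<dagger> * dg n d * coord_frame n k) $$ (i, j) = dg k d $$ (i, j)" .
qed auto

lemma coord_frame_isometry: "k \<le> n \<Longrightarrow> (coord_frame n k)\<^sup>\<dagger> * coord_frame n k = 1\<^sub>m k"
  using coord_frame_dg[of k n "\<lambda>_. 1"] by simp

lemma congruence_inverse:
  assumes S: "S \<in> carrier_mat n n" and R: "R \<in> carrier_mat n n" and RS: "R * S = 1\<^sub>m n"
    and f: "\<And>i. i < n \<Longrightarrow> f i \<noteq> 0"
  shows "(R\<^sup>\<dagger> * dg n (\<lambda>i. 1 / f i) * R) * (S * dg n f * S\<^sup>\<dagger>) = 1\<^sub>m n"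
proof -
  have SR: "R\<^sup>\<dagger> * S\<^sup>\<dagger> = 1\<^sub>m n"
  proof -
    have "S * R = 1\<^sub>m n" by (rule mat_mult_left_right_inverse[OF R S RS])
    then have "(S * R)\<^sup>\<dagger> = 1\<^sub>m n" by simp
    then show ?thesis using R S by (simp add: adj_mult_dim)
  qed
  have "(R\<^sup>\<dagger> * dg n (\<lambda>i. 1 / f i) * R) * (S * dg n f * S\<^sup>\<dagger>)
      = R\<^sup>\<dagger> * (dg n (\<lambda>i. 1 / f i) * ((R * S) * (dg n f * S\<^sup>\<dagger>)))"
    using S R by (simp add: mat_assoc)
  also have "(R * S) * (dg n f * S\<^sup>\<dagger>) = dg n f * S\<^sup>\<dagger>" unfolding RS using S by simp
  also have "dg n (\<lambda>i. 1 / f i) * (dg n f * S\<^sup>\<dagger>) = (dg n (\<lambda>i. 1 / f i) * dg n f) * S\<^sup>\<dagger>"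
    using S by (simp add: mat_assoc del: mat_diag_diag)
  also have "dg n (\<lambda>i. 1 / f i) * dg n f = 1\<^sub>m n" unfolding dg_dg by (rule dg_eq_one) (use f in auto)
  finally show ?thesis using S SR by simp
qed

lemma left_inverse_eigen:
  assumes A: "eigen_decomp n A U a" and a: "\<And>i. i < n \<Longrightarrow> a i \<noteq> 0"
    and X: "X \<in> carrier_mat n n" "X * A = 1\<^sub>m n"
  shows "X = U * dg n (\<lambda>i. 1 / a i) * U\<^sup>\<dagger>"
proof -
  have U: "unitary n U" "U \<in> carrier_mat n n" "U\<^sup>\<dagger> * U = 1\<^sub>m n" and Aeq: "A = U * dg n a * U\<^sup>\<dagger>"
    using A by (auto simp: eigen_decomp_def unitary_def)
  let ?Y = "U * dg n (\<lambda>i. 1 / a i) * U\<^sup>\<dagger>"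
  have "?Y * A = 1\<^sub>m n"
    using congruence_inverse[of U n "U\<^sup>\<dagger>" a] U a by (simp add: Aeq)
  then have AY: "A * ?Y = 1\<^sub>m n"
    using mat_mult_left_right_inverse[of ?Y n A] U eigen_decomp_carrier[OF A] by simp
  have "X = X * (A * ?Y)" unfolding AY using X by simp
  also have "\<dots> = (X * A) * ?Y" using X U eigen_decomp_carrier[OF A]
    by (intro assoc_mult_mat[symmetric]) auto
  finally show ?thesis unfolding X(2) using U by simp
qed

text \<open>Here \<open>X\<close> is the inverse of \<open>A\<close>. For \<open>Y = A\<^sup>-\<^sup>1\<^sup>/\<^sup>2 V\<close> one has \<open>Y\<^sup>* Y = V\<^sup>* X V\<close>, while the compression
  of \<open>A\<close> along \<open>Y\<close> is the identity; so the lower bound for determinants of compressions of \<open>A\<close> is an upper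
  bound for those of its inverse. The unitary \<open>U\<^sup>*\<close> in the definition of \<open>Y\<close> below only passes to
  eigenvector coordinates.\<close>

lemma det_inverse_compression_le:
  assumes A: "eigen_decomp n A U a" and a: "mono_on {..<n} a" "\<And>i. i < n \<Longrightarrow> 0 < a i"
    and X: "X \<in> carrier_mat n n" "X * A = 1\<^sub>m n"
    and V: "V \<in> carrier_mat n k" "V\<^sup>\<dagger> * V = 1\<^sub>m k" and k: "k \<le> n"
  shows "(\<Prod>i<k. a i) * Re (Determinant.det (V\<^sup>\<dagger> * X * V)) \<le> 1"
proof -
  have U: "unitary n U" "U \<in> carrier_mat n n" using A by (auto simp: eigen_decomp_def unitary_def)
  have a0: "a i \<noteq> 0" if "i < n" for i using a(2)[OF that] by simp
  have Xeq: "X = U * dg n (\<lambda>i. 1 / a i) * U\<^sup>\<dagger>" by (rule left_inverse_eigen[OF A a0 X])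
  define r where "r i = 1 / sqrt (a i)" for i
  have rr: "dg n r * dg n r = dg n (\<lambda>i. 1 / a i)"
    unfolding dg_dg by (rule dg_cong) (use a(2) in \<open>auto simp: r_def less_imp_le\<close>)
  have rar: "dg n r * (dg n a * dg n r) = 1\<^sub>m n"
    unfolding dg_dg
  proof (rule dg_eq_one)
    fix i assume "i < n"
    then have "0 < a i" by (rule a(2))
    moreover have "r i * (a i * r i) = a i / (sqrt (a i) * sqrt (a i))" by (simp add: r_def)
    ultimately show "r i * (a i * r i) = 1" by simp
  qed
  have sr: "dg n (\<lambda>i. sqrt (a i)) * dg n r = 1\<^sub>m n"
    unfolding dg_dg
  proof (rule dg_eq_one)
    fix i assume "i < n"
    then show "sqrt (a i) * r i = 1" using a(2)[of i] by (simp add: r_def)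
  qed
  define Y where "Y = dg n r * (U\<^sup>\<dagger> * V)"
  define L where "L = V\<^sup>\<dagger> * U * dg n (\<lambda>i. sqrt (a i))"
  have Y: "Y \<in> carrier_mat n k" and L: "L \<in> carrier_mat k n" using U V by (auto simp: Y_def L_def)
  have "L * Y = V\<^sup>\<dagger> * (U * ((dg n (\<lambda>i. sqrt (a i)) * dg n r) * (U\<^sup>\<dagger> * V)))"
    using U V by (simp add: Y_def L_def mat_assoc del: mat_diag_diag)
  then have LY: "L * Y = 1\<^sub>m k"
    unfolding sr using U V unitary_cancel[OF U(1), of V] by simp
  have "Y\<^sup>\<dagger> * Y = V\<^sup>\<dagger> * (U * ((dg n r * dg n r) * (U\<^sup>\<dagger> * V)))"
    using U V by (simp add: Y_def adj_mult_dim mat_assoc del: mat_diag_diag)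
  then have YY: "Y\<^sup>\<dagger> * Y = V\<^sup>\<dagger> * X * V" unfolding rr Xeq using U V by (simp add: mat_assoc)
  have "Y\<^sup>\<dagger> * dg n a * Y = V\<^sup>\<dagger> * (U * ((dg n r * (dg n a * dg n r)) * (U\<^sup>\<dagger> * V)))"
    using U V by (simp add: Y_def adj_mult_dim mat_assoc del: mat_diag_diag)
  then have YaY: "Y\<^sup>\<dagger> * dg n a * Y = 1\<^sub>m k"
    unfolding rar using U V unitary_cancel[OF U(1), of V] by simp
  show ?thesis using det_compression_ge[OF Y L LY k a] unfolding YY YaY by simp
qed

text \<open>Log-convexity bounds determinants of compressions from above, whereas the product of the smallest
  eigenvalues is wanted from below. Hence the argument is carried out for the inverses, along the
  eigenvectors of the geometric mean itself, where its compression is diagonal and the bound is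
  attained.\<close>

lemma prod_smallest_geometric_mean:
  assumes S: "S \<in> carrier_mat n n" and R: "R \<in> carrier_mat n n" and RS: "R * S = 1\<^sub>m n" "S * R = 1\<^sub>m n"
    and e: "\<And>i. i < n \<Longrightarrow> 0 < e i" and t: "0 \<le> t" "t \<le> 1" and k: "k \<le> n"
    and A: "eigen_decomp n (S * dg n (\<lambda>_. 1) * S\<^sup>\<dagger>) UA a" "mono_on {..<n} a" "\<And>i. i < n \<Longrightarrow> 0 < a i"
    and B: "eigen_decomp n (S * dg n e * S\<^sup>\<dagger>) UB b" "mono_on {..<n} b" "\<And>i. i < n \<Longrightarrow> 0 < b i"
    and C: "eigen_decomp n (S * dg n (\<lambda>i. e i powr t) * S\<^sup>\<dagger>) UC c" "\<And>i. i < n \<Longrightarrow> 0 < c i"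
  shows "(\<Prod>i<k. a i) powr (1 - t) * (\<Prod>i<k. b i) powr t \<le> (\<Prod>i<k. c i)"
proof -
  have U: "unitary n UC" "UC \<in> carrier_mat n n" "UC\<^sup>\<dagger> * UC = 1\<^sub>m n"
    using C by (auto simp: eigen_decomp_def unitary_def)
  have c0: "c i \<noteq> 0" if "i < n" for i using C(2)[OF that] by simp
  define V where "V = UC * coord_frame n k"
  have V: "V \<in> carrier_mat n k" using U by (simp add: V_def)
  have VV: "V\<^sup>\<dagger> * V = 1\<^sub>m k"
    using U unitary_cancel[OF U(1)] coord_frame_isometry[OF k] by (simp add: V_def adj_mult_dim mat_assoc)
  define X where "X f = R\<^sup>\<dagger> * dg n (\<lambda>i. 1 / f i) * R" for f
  have X: "X f \<in> carrier_mat n n" for f using R by (simp add: X_def)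
  have X_inv: "X f * (S * dg n f * S\<^sup>\<dagger>) = 1\<^sub>m n" if "\<And>i. i < n \<Longrightarrow> f i \<noteq> 0" for f
    unfolding X_def by (rule congruence_inverse[OF S R RS(1) that])
  define Y where "Y = R * V"
  define L where "L = V\<^sup>\<dagger> * S"
  have Y: "Y \<in> carrier_mat n k" and L: "L \<in> carrier_mat k n" using R V S by (auto simp: Y_def L_def)
  have "L * Y = V\<^sup>\<dagger> * ((S * R) * V)" using R V S by (simp add: Y_def L_def mat_assoc del: RS)
  then have LY: "L * Y = 1\<^sub>m k" unfolding RS using V VV by simp
  have XY: "V\<^sup>\<dagger> * X f * V = Y\<^sup>\<dagger> * dg n (\<lambda>i. 1 / f i) * Y" for f
    using R V by (simp add: X_def Y_def adj_mult_dim mat_assoc)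
  define dA where "dA = Re (Determinant.det (Y\<^sup>\<dagger> * Y))"
  define dB where "dB = Re (Determinant.det (Y\<^sup>\<dagger> * dg n (\<lambda>i. 1 / e i) * Y))"
  define pa where "pa = (\<Prod>i<k. a i)"
  define pb where "pb = (\<Prod>i<k. b i)"
  define pc where "pc = (\<Prod>i<k. c i)"
  have pos: "0 < pa" "0 < pb" "0 < pc" unfolding pa_def pb_def pc_def
    using A(3) B(3) C(2) k by (auto intro!: prod_pos)
  have "Y\<^sup>\<dagger> * dg n (\<lambda>i. 1 / 1) * Y = Y\<^sup>\<dagger> * Y" using Y by simp
  then have "pa * dA \<le> 1"
    using det_inverse_compression_le[OF A X X_inv V VV k] XY[of "\<lambda>_. 1"] by (simp add: pa_def dA_def)
  then have 1: "dA \<le> 1 / pa" using pos by (simp add: field_simps)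
  have e0: "e i \<noteq> 0" if "i < n" for i using e[OF that] by simp
  have "pb * dB \<le> 1"
    using det_inverse_compression_le[OF B X X_inv[of e, OF e0] V VV k] XY[of e] by (simp add: pb_def dB_def)
  then have 2: "dB \<le> 1 / pb" using pos by (simp add: field_simps)
  have pdY: "pd k (Y\<^sup>\<dagger> * dg n f * Y)" if "\<And>i. i < n \<Longrightarrow> 0 < f i" for f
    by (rule pd_congruence[OF pd_dg Y L LY]) (use that in auto)
  have d0: "0 \<le> dA" "0 \<le> dB"
    using det_pd(2)[OF pdY[of "\<lambda>_. 1"]] det_pd(2)[OF pdY[of "\<lambda>i. 1 / e i"]] e Y
    by (auto simp: dA_def dB_def)
  let ?et = "\<lambda>i. e i powr t"
  have et0: "?et i \<noteq> 0" if "i < n" for i using e[OF that] by simp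
  have "X ?et = UC * dg n (\<lambda>i. 1 / c i) * UC\<^sup>\<dagger>"
    by (rule left_inverse_eigen[OF C(1) c0 X X_inv[OF et0]])
  then have "V\<^sup>\<dagger> * X ?et * V = (coord_frame n k)\<^sup>\<dagger> * dg n (\<lambda>i. 1 / c i) * coord_frame n k"
    using U unitary_cancel[OF U(1)] by (simp add: V_def adj_mult_dim mat_assoc)
  then have Yt: "Y\<^sup>\<dagger> * dg n (\<lambda>i. 1 / ?et i) * Y = dg k (\<lambda>i. 1 / c i)"
    unfolding coord_frame_dg[OF k] XY by simp
  have et: "dg n (\<lambda>i. (1 / e i) powr t) = dg n (\<lambda>i. 1 / ?et i)"
    by (rule dg_cong) (use e in \<open>auto simp: powr_divide less_imp_le\<close>)
  have "Re (Determinant.det (Y\<^sup>\<dagger> * dg n (\<lambda>i. (1 / e i) powr t) * Y)) \<le> dA powr (1 - t) * dB powr t"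
    unfolding dA_def dB_def by (rule det_compression_powr_le[OF Y L LY]) (use e t in auto)
  then have "1 / pc \<le> dA powr (1 - t) * dB powr t"
    unfolding et Yt Re_det_dg by (simp add: pc_def prod_dividef)
  also have "\<dots> \<le> (1 / pa) powr (1 - t) * (1 / pb) powr t"
    using 1 2 d0 t by (intro mult_mono powr_mono2) auto
  also have "\<dots> = 1 / (pa powr (1 - t) * pb powr t)" using pos by (simp add: powr_divide)
  finally have "1 / pc \<le> 1 / (pa powr (1 - t) * pb powr t)" .
  moreover have "0 < pa powr (1 - t) * pb powr t" using pos by simp
  ultimately have "pa powr (1 - t) * pb powr t \<le> pc"
    using pos(3) inverse_le_iff_le[of pc "pa powr (1 - t) * pb powr t"] by (simp only: inverse_eq_divide)
  then show ?thesis by (simp only: pa_def pb_def pc_def)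
qed

text \<open>The bound on diagonal entries is used twice in this form, with a matrix \<open>U\<close> of eigenvectors of another
  operator than \<open>X\<close>: of the average when \<open>X\<close> is one of the averaged means, and of the limit when \<open>X\<close>
  approximates it.\<close>

lemma prod_smallest_le_prod_qf:
  assumes X: "eigen_decomp n X W d" "mono_on {..<n} d" "\<And>i. i < n \<Longrightarrow> 0 < d i"
    and U: "unitary n U" and k: "k \<le> n"
  shows "(\<Prod>i<k. d i) \<le> (\<Prod>j<k. qf X (col U j))"
proof -
  have Uc: "U \<in> carrier_mat n n" and W: "unitary n W" "W \<in> carrier_mat n n"
    using U X by (auto simp: eigen_decomp_def unitary_def)
  define Z where "Z = W\<^sup>\<dagger> * U * coord_frame n k"
  have Z: "Z \<in> carrier_mat n k" using W Uc by (simp add: Z_def)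
  have "W * (W\<^sup>\<dagger> * (U * coord_frame n k)) = U * coord_frame n k"
    using unitary_cancel(2)[OF W(1)] Uc by simp
  then have ZZ: "Z\<^sup>\<dagger> * Z = 1\<^sub>m k"
    using Uc W(2) unitary_cancel(1)[OF U] coord_frame_isometry[OF k]
    by (simp add: Z_def adj_mult_dim mat_assoc)
  have "(\<Prod>i<k. d i) \<le> (\<Prod>j<k. Re ((Z\<^sup>\<dagger> * dg n d * Z) $$ (j, j)))"
    by (rule prod_diag_ge_prod_smallest[OF Z ZZ k X(2,3)])
  also have "\<dots> = (\<Prod>j<k. qf X (col U j))"
  proof (rule prod.cong)
    fix j assume "j \<in> {..<k}"
    then have j: "j < k" by simp
    have "Z $$ (i, j) = (W\<^sup>\<dagger> *\<^sub>v col U j) $ i" if i: "i < n" for i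
    proof -
      have "Z $$ (i, j) = (W\<^sup>\<dagger> * U) $$ (i, j)"
        unfolding Z_def by (rule mult_coord_frame) (use W Uc k i j in auto)
      then show ?thesis using W Uc i j k by simp
    qed
    moreover have "col U j \<in> carrier_vec n" using Uc by auto
    ultimately show "Re ((Z\<^sup>\<dagger> * dg n d * Z) $$ (j, j)) = qf X (col U j)"
      unfolding diag_congruence_dg[OF Z j] using qf_eigen[OF X(1), of "col U j"]
      by (simp add: mult.commute)
  qed simp
  finally show ?thesis .
qed

section \<open>Averages of weighted geometric means\<close>

lemma pd_congruence_dg:
  assumes S: "S \<in> carrier_mat n n" and R: "R \<in> carrier_mat n n" "S * R = 1\<^sub>m n" and f: "\<And>i. i < n \<Longrightarrow> 0 < f i"
  shows "pd n (S * dg n f * S\<^sup>\<dagger>)"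
proof -
  have "R\<^sup>\<dagger> * S\<^sup>\<dagger> = (S * R)\<^sup>\<dagger>" using S R(1) by (simp add: adj_mult_dim)
  then have "R\<^sup>\<dagger> * S\<^sup>\<dagger> = 1\<^sub>m n" using R(2) by simp
  moreover have "pd n (dg n f)" by (rule pd_dg[OF f])
  ultimately show ?thesis
    using pd_congruence[of n "dg n f" "S\<^sup>\<dagger>" n "R\<^sup>\<dagger>"] S R by simp
qed

locale power_average = prob_space \<nu> for \<nu> :: "real measure" +
  fixes h :: "real \<Rightarrow> real"
  assumes sets_measure: "sets \<nu> = sets (restrict_space borel {0..1})"
    and h_eq: "\<And>x. 0 \<le> x \<Longrightarrow> h x = (\<integral>\<alpha>. rpow x \<alpha> \<partial>\<nu>)"
begin

lemma space_measure: "space \<nu> = {0..1}"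
  using sets_eq_imp_space_eq[OF sets_measure] by (simp add: space_restrict_space)

text \<open>For \<open>0 \<le> \<alpha> \<le> 1\<close> the power \<open>x\<^sup>\<alpha>\<close> lies between \<open>min 1 x\<close> and \<open>max 1 x\<close>.\<close>

lemma integrable_powr:
  assumes "0 < x"
  shows "integrable \<nu> (\<lambda>\<alpha>. x powr \<alpha>)"
proof (rule integrable_const_bound[of _ "max 1 x"])
  have "x powr \<alpha> \<le> max 1 x" if "0 \<le> \<alpha>" "\<alpha> \<le> 1" for \<alpha>
  proof (cases "x \<le> 1")
    case True
    then show ?thesis using powr_le1[of \<alpha> x] that assms by simp
  next
    case False
    then show ?thesis using powr_mono[of \<alpha> 1 x] that assms by simp
  qed
  then show "AE \<alpha> in \<nu>. norm (x powr \<alpha>) \<le> max 1 x"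
    by (intro AE_I2) (auto simp: space_measure)
  have "(\<lambda>\<alpha>. x powr \<alpha>) \<in> borel_measurable (restrict_space borel {0..1})"
    by (rule measurable_restrict_space1) measurable
  then show "(\<lambda>\<alpha>. x powr \<alpha>) \<in> borel_measurable \<nu>"
    using measurable_cong_sets[OF sets_measure refl] by blast
qed

lemma h_pos_eq:
  assumes "0 < x"
  shows "h x = (\<integral>\<alpha>. x powr \<alpha> \<partial>\<nu>)"
proof -
  have "rpow x = (\<lambda>\<alpha>. x powr \<alpha>)" using assms by (auto simp: rpow_def)
  then show ?thesis using h_eq[of x] assms by simp
qed

lemma h_pos:
  assumes "0 < x"
  shows "0 < h x"
proof -
  have "min 1 x \<le> x powr \<alpha>" if "0 \<le> \<alpha>" "\<alpha> \<le> 1" for \<alpha>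
  proof (cases "x \<le> 1")
    case True
    then show ?thesis using powr_mono'[of \<alpha> 1 x] that assms by simp
  next
    case False
    then show ?thesis using ge_one_powr_ge_zero[of x \<alpha>] that by simp
  qed
  then have "min 1 x \<le> (\<integral>\<alpha>. x powr \<alpha> \<partial>\<nu>)"
    by (intro integral_ge_const integrable_powr AE_I2) (use assms in \<open>auto simp: space_measure\<close>)
  then show ?thesis using h_pos_eq[OF assms] assms by linarith
qed

lemma pd_inv_mean:
  assumes "pd n A" "pd n B"
  shows "pd n (inv_mean h A B)"
proof -
  obtain S R e where S: "S \<in> carrier_mat n n" "R \<in> carrier_mat n n" "S * R = 1\<^sub>m n"
    and e: "\<And>i. i < n \<Longrightarrow> 0 < e i"
    and mean: "\<And>h. inv_mean h A B = S * dg n (\<lambda>i. h (e i)) * S\<^sup>\<dagger>"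
    by (rule inv_mean_congruence[OF assms]) (rule that, assumption+)
  show ?thesis unfolding mean by (rule pd_congruence_dg[OF S]) (rule h_pos[OF e])
qed

text \<open>The \<open>k\<close>-th root of the product of the smallest eigenvalues is an infimum of linear functionals, by the
  arithmetic-geometric mean inequality, and hence superadditive under averaging. The functional with
  coefficients \<open>g / c j\<close> at the eigenvectors of the averaged matrix attains the infimum there: these
  coefficients have product 1 and make all the terms \<open>g / c j * c j\<close> equal.\<close>

lemma smallest_inv_mean_ge:
  assumes A: "eigen_decomp n A UA a" "mono_on {..<n} a" "\<And>i. i < n \<Longrightarrow> 0 < a i"
    and B: "eigen_decomp n B UB b" "mono_on {..<n} b" "\<And>i. i < n \<Longrightarrow> 0 < b i"
    and C: "eigen_decomp n (inv_mean h A B) U c" "\<And>i. i < n \<Longrightarrow> 0 < c i"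
    and k: "1 \<le> k" "k \<le> n"
  defines "a' \<equiv> root k (\<Prod>i<k. a i)" and "b' \<equiv> root k (\<Prod>i<k. b i)"
  shows "a' * h (b' / a') \<le> root k (\<Prod>i<k. c i)"
proof -
  have pdA: "pd n A" and pdB: "pd n B" using pd_iff_eigen[OF A(1)] pd_iff_eigen[OF B(1)] A(3) B(3) by auto
  obtain S R e where S: "S \<in> carrier_mat n n" and R: "R \<in> carrier_mat n n"
    and SR: "S * R = 1\<^sub>m n" and RS: "R * S = 1\<^sub>m n"
    and e: "\<And>i. i < n \<Longrightarrow> 0 < e i"
    and Aeq: "A = S * dg n (\<lambda>_. 1) * S\<^sup>\<dagger>" and Beq: "B = S * dg n e * S\<^sup>\<dagger>"
    and mean: "\<And>h. inv_mean h A B = S * dg n (\<lambda>i. h (e i)) * S\<^sup>\<dagger>"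
    by (rule inv_mean_congruence[OF pdA pdB]) (rule that, assumption+)
  have U: "unitary n U" using C by (simp add: eigen_decomp_def)
  have pos: "0 < (\<Prod>i<k. a i)" "0 < (\<Prod>i<k. b i)" "0 < (\<Prod>i<k. c i)"
    using A(3) B(3) C(2) k by (auto intro!: prod_pos)
  have a'b': "0 < a'" "0 < b'" using pos k by (auto simp: a'_def b'_def)
  have a'b'k: "a' ^ k = (\<Prod>i<k. a i)" "b' ^ k = (\<Prod>i<k. b i)"
    using pos k by (auto simp: a'_def b'_def less_imp_le)
  define g where "g = root k (\<Prod>i<k. c i)"
  have g: "0 < g" "g ^ k = (\<Prod>i<k. c i)" using pos k by (auto simp: g_def less_imp_le)
  define q where "q i j = (cmod ((S\<^sup>\<dagger> *\<^sub>v col U j) $ i))\<^sup>2" for i j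
  define x where "x t j = (\<Sum>i<n. e i powr t * q i j)" for t j
  have colU: "col U j \<in> carrier_vec n" if "j < n" for j
    using qf_eigenvector[OF C(1) that] by blast
  have x_eq: "x t j = qf (S * dg n (\<lambda>i. e i powr t) * S\<^sup>\<dagger>) (col U j)" if "j < n" for t j
    unfolding qf_congruence_dg[OF S colU[OF that]] x_def q_def ..
  have pointwise: "a' * (b' / a') powr t \<le> (\<Sum>j<k. g / c j * x t j) / k" if t: "0 \<le> t" "t \<le> 1" for t
  proof -
    let ?Ct = "S * dg n (\<lambda>i. e i powr t) * S\<^sup>\<dagger>"
    have "pd n ?Ct" by (rule pd_congruence_dg[OF S R SR]) (use e in force)
    then obtain W d where Ct: "eigen_decomp n ?Ct W d" "mono_on {..<n} d" "\<And>i. i < n \<Longrightarrow> 0 < d i"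
      using pd_eigen_decomp by blast
    have le: "(\<Prod>i<k. a i) powr (1 - t) * (\<Prod>i<k. b i) powr t \<le> (\<Prod>i<k. d i)"
      by (rule prod_smallest_geometric_mean[OF S R RS SR e t k(2),
            where UA = UA and a = a and UB = UB and b = b and UC = W and c = d])
        (use A B Ct Aeq Beq in auto)
    also have "\<dots> \<le> (\<Prod>j<k. x t j)"
      using prod_smallest_le_prod_qf[OF Ct U k(2)] x_eq k by simp
    also have "\<dots> = (\<Prod>j<k. g / c j * x t j)"
    proof -
      have "(\<Prod>j<k. g / c j) = 1" using g(2) C(2) k unfolding prod_dividef by (auto simp: less_imp_neq[symmetric])
      then show ?thesis unfolding prod.distrib by simp
    qed
    finally have 1: "(\<Prod>i<k. a i) powr (1 - t) * (\<Prod>i<k. b i) powr t \<le> (\<Prod>j<k. g / c j * x t j)" .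
    have x0: "0 \<le> g / c j * x t j" if "j < k" for j
    proof -
      have "0 \<le> x t j" unfolding x_def q_def by (intro sum_nonneg) simp
      moreover have "0 < g / c j" using that g(1) C(2)[of j] k by simp
      ultimately show ?thesis by (intro mult_nonneg_nonneg) auto
    qed
    have "a' * (b' / a') powr t = a' powr (1 - t) * b' powr t"
      using a'b' by (simp add: powr_divide powr_diff)
    also have "\<dots> = ((\<Prod>i<k. a i) powr (1 - t) * (\<Prod>i<k. b i) powr t) powr (1 / k)"
      unfolding a'b'k[symmetric] using a'b' k
      by (simp add: powr_mult powr_powr powr_realpow[symmetric])
    also have "\<dots> \<le> (\<Prod>j<k. g / c j * x t j) powr (1 / k)"
      using 1 by (intro powr_mono2) auto
    also have "\<dots> \<le> (\<Sum>j<k. g / c j * x t j / k)"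
      using arith_geom_mean[of "{..<k}" "\<lambda>j. g / c j * x t j"] x0 k by (simp add: lessThan_empty_iff)
    finally show ?thesis by (simp add: sum_divide_distrib)
  qed
  have int_x: "integrable \<nu> (\<lambda>t. x t j)" for j
    unfolding x_def using e by (intro Bochner_Integration.integrable_sum integrable_mult_left integrable_powr) auto
  have x_avg: "(\<integral>t. x t j \<partial>\<nu>) = c j" if "j < n" for j
  proof -
    have "(\<integral>t. x t j \<partial>\<nu>) = (\<Sum>i<n. \<integral>t. e i powr t * q i j \<partial>\<nu>)"
      unfolding x_def by (rule Bochner_Integration.integral_sum) (use e integrable_powr in auto)
    also have "\<dots> = (\<Sum>i<n. h (e i) * q i j)"
      by (intro sum.cong refl) (use e h_pos_eq in auto)
    also have "\<dots> = qf (inv_mean h A B) (col U j)"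
      unfolding mean qf_congruence_dg[OF S colU[OF that]] q_def ..
    also have "\<dots> = c j" by (rule qf_eigenvector(1)[OF C(1) that])
    finally show ?thesis .
  qed
  have "a' * h (b' / a') = (\<integral>t. a' * (b' / a') powr t \<partial>\<nu>)"
    using h_pos_eq[of "b' / a'"] a'b' by simp
  also have "\<dots> \<le> (\<integral>t. (\<Sum>j<k. g / c j * x t j) / k \<partial>\<nu>)"
    using a'b' int_x pointwise integrable_powr[of "b' / a'"]
    by (intro integral_mono) (auto simp: space_measure)
  also have "\<dots> = (\<Sum>j<k. g / c j * (\<integral>t. x t j \<partial>\<nu>)) / k"
    using int_x by (simp add: Bochner_Integration.integral_sum)
  also have "\<dots> = (\<Sum>j<k. g) / k"
    using x_avg k C(2) by (intro arg_cong[of _ _ "\<lambda>y. y / real k"] sum.cong) (auto simp: less_imp_neq[symmetric])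
  also have "\<dots> = g" using k by simp
  finally show ?thesis by (simp add: g_def)
qed

end

section \<open>Monotonicity of the mean\<close>

text \<open>Substituting \<open>t = x s\<close> shows that the integral is \<open>x\<^sup>\<alpha>\<close> times its value at \<open>x = 1\<close>. That value is
  finite since the integrand is at most \<open>t\<^sup>\<alpha>\<^sup>-\<^sup>1\<close> near 0 and at most \<open>t\<^sup>\<alpha>\<^sup>-\<^sup>2\<close> near infinity.\<close>

lemma powr_stieltjes:
  fixes \<alpha> :: real
  assumes \<alpha>: "0 < \<alpha>" "\<alpha> < 1"
  obtains c where "0 < c" "\<And>x. 0 < x \<Longrightarrow>
    (\<integral>\<^sup>+t. ennreal (x / (x + t) * t powr (\<alpha> - 1)) * indicator {0<..} t \<partial>lborel) = ennreal (c * x powr \<alpha>)"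
proof -
  define J :: "real \<Rightarrow> ennreal" where
    "J x = (\<integral>\<^sup>+t. ennreal (x / (x + t) * t powr (\<alpha> - 1)) * indicator {0<..} t \<partial>lborel)" for x
  have scale: "J x = ennreal (x powr \<alpha>) * J 1" if x: "0 < x" for x
  proof -
    have "J x = ennreal x * (\<integral>\<^sup>+s. ennreal (x / (x + x * s) * (x * s) powr (\<alpha> - 1)) * indicator {0<..} (x * s) \<partial>lborel)"
      unfolding J_def using x by (subst nn_integral_real_affine[of _ x 0]) auto
    also have "(\<integral>\<^sup>+s. ennreal (x / (x + x * s) * (x * s) powr (\<alpha> - 1)) * indicator {0<..} (x * s) \<partial>lborel)
       = (\<integral>\<^sup>+s. ennreal (x powr (\<alpha> - 1)) * (ennreal (1 / (1 + s) * s powr (\<alpha> - 1)) * indicator {0<..} s) \<partial>lborel)"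
    proof (rule nn_integral_cong)
      fix s :: real
      show "ennreal (x / (x + x * s) * (x * s) powr (\<alpha> - 1)) * indicator {0<..} (x * s)
        = ennreal (x powr (\<alpha> - 1)) * (ennreal (1 / (1 + s) * s powr (\<alpha> - 1)) * indicator {0<..} s)"
      proof (cases "0 < s")
        case True
        have "x / (x + x * s) = x / (x * (1 + s))" by (simp add: algebra_simps)
        then have "x / (x + x * s) = 1 / (1 + s)" using x by simp
        then show ?thesis using True x
          by (simp add: powr_mult indicator_def ennreal_mult'[symmetric] mult_ac del: mult_eq_0_iff)
      next
        case False
        then show ?thesis using x by (simp add: indicator_def zero_less_mult_iff)
      qed
    qed
    also have "\<dots> = ennreal (x powr (\<alpha> - 1)) * J 1"
      unfolding J_def by (subst nn_integral_cmult) auto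
    also have "ennreal x * (ennreal (x powr (\<alpha> - 1)) * J 1) = ennreal (x * x powr (\<alpha> - 1)) * J 1"
      using x by (simp add: ennreal_mult mult.assoc)
    also have "x * x powr (\<alpha> - 1) = x powr \<alpha>" using x by (simp add: powr_diff)
    finally show ?thesis .
  qed
  have "J 1 \<le> (\<integral>\<^sup>+t. ennreal (t powr (\<alpha> - 1)) * indicator {0..1} t + ennreal (t powr (\<alpha> - 2)) * indicator {1..} t \<partial>lborel)"
    unfolding J_def
  proof (rule nn_integral_mono)
    fix t :: real
    show "ennreal (1 / (1 + t) * t powr (\<alpha> - 1)) * indicator {0<..} t
      \<le> ennreal (t powr (\<alpha> - 1)) * indicator {0..1} t + ennreal (t powr (\<alpha> - 2)) * indicator {1..} t"
    proof (cases "0 < t")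
      case t: True
      show ?thesis
      proof (cases "t \<le> 1")
        case True
        have "1 / (1 + t) * t powr (\<alpha> - 1) \<le> 1 * t powr (\<alpha> - 1)"
          using t by (intro mult_right_mono) auto
        then show ?thesis using t True by (auto simp: indicator_def ennreal_leI add_increasing2)
      next
        case False
        have "1 / (1 + t) * t powr (\<alpha> - 1) \<le> 1 / t * t powr (\<alpha> - 1)"
          using t by (intro mult_right_mono) (auto simp: field_simps)
        also have "\<dots> = t powr (\<alpha> - 1 - 1)" using t by (subst powr_diff[of t "\<alpha> - 1" 1]) simp
        finally show ?thesis using t False by (auto simp: indicator_def ennreal_leI)
      qed
    qed simp
  qed
  also have "\<dots> = ennreal (1 powr (\<alpha> - 1 + 1) / (\<alpha> - 1 + 1)) + ennreal (- (1 powr (\<alpha> - 2 + 1)) / (\<alpha> - 2 + 1))"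
  proof -
    have "(\<integral>\<^sup>+t. ennreal (t powr (\<alpha> - 1)) * indicator {0..1} t \<partial>lborel) = ennreal (1 powr (\<alpha> - 1 + 1) / (\<alpha> - 1 + 1))"
      using \<alpha> by (intro nn_integral_has_integral_lebesgue' has_integral_powr_from_0) auto
    moreover have "(\<integral>\<^sup>+t. ennreal (t powr (\<alpha> - 2)) * indicator {1..} t \<partial>lborel) = ennreal (- (1 powr (\<alpha> - 2 + 1)) / (\<alpha> - 2 + 1))"
      using \<alpha> by (intro nn_integral_has_integral_lebesgue' has_integral_powr_to_inf) auto
    ultimately show ?thesis by (subst nn_integral_add) auto
  qed
  also have "\<dots> < \<infinity>" by simp
  finally have fin: "J 1 < \<infinity>" .
  \<comment> \<open>The integral is not zero: on \<open>[1, 2]\<close> the factors \<open>1 / (1 + t)\<close> and \<open>t\<^sup>\<alpha>\<^sup>-\<^sup>1\<close> are at least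
    1/3 and 1/2.\<close>
  have "(\<integral>\<^sup>+t. ennreal (1 / 6) * indicator {1..2::real} t \<partial>lborel) \<le> J 1"
    unfolding J_def
  proof (rule nn_integral_mono)
    fix t :: real
    show "ennreal (1 / 6) * indicator {1..2} t \<le> ennreal (1 / (1 + t) * t powr (\<alpha> - 1)) * indicator {0<..} t"
    proof (cases "1 \<le> t \<and> t \<le> 2")
      case True
      have "1 / 2 \<le> t powr (-1)" using True by (simp add: powr_minus_divide field_simps)
      also have "\<dots> \<le> t powr (\<alpha> - 1)" using True \<alpha> by (intro powr_mono) auto
      finally have "1 / 3 * (1 / 2) \<le> 1 / (1 + t) * t powr (\<alpha> - 1)"
        using True by (intro mult_mono) (auto simp: field_simps)
      then show ?thesis using True by (auto simp: indicator_def intro!: ennreal_leI)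
    next
      case False
      then have "indicator {1..2} t = (0 :: ennreal)" by (auto simp: indicator_def)
      then show ?thesis by simp
    qed
  qed
  also have "(\<integral>\<^sup>+t. ennreal (1 / 6) * indicator {1..2::real} t \<partial>lborel) = ennreal (1 / 6)"
    by (subst nn_integral_cmult) auto
  finally have pos: "ennreal (1 / 6) \<le> J 1" .
  define c where "c = enn2real (J 1)"
  have c: "J 1 = ennreal c" using fin by (simp add: c_def)
  have "0 < c" using pos enn2real_mono[OF pos] fin by (simp add: c_def)
  moreover have "J x = ennreal (c * x powr \<alpha>)" if "0 < x" for x
    using scale[OF that] \<open>0 < c\<close> by (simp add: c ennreal_mult mult.commute)
  ultimately show ?thesis using that unfolding J_def by blast
qed

lemma sum_powr_mono:
  fixes e Q :: "'i \<Rightarrow> real" and e' Q' :: "'j \<Rightarrow> real"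
  assumes fin: "finite I" "finite I'"
    and e: "\<And>i. i \<in> I \<Longrightarrow> 0 < e i" "\<And>i. i \<in> I \<Longrightarrow> 0 \<le> Q i"
    and e': "\<And>i. i \<in> I' \<Longrightarrow> 0 < e' i" "\<And>i. i \<in> I' \<Longrightarrow> 0 \<le> Q' i"
    and le: "\<And>t. 0 < t \<Longrightarrow> (\<Sum>i\<in>I. e i / (e i + t) * Q i) \<le> (\<Sum>i\<in>I'. e' i / (e' i + t) * Q' i)"
    and \<alpha>: "0 < \<alpha>" "\<alpha> < 1"
  shows "(\<Sum>i\<in>I. e i powr \<alpha> * Q i) \<le> (\<Sum>i\<in>I'. e' i powr \<alpha> * Q' i)"
proof -
  obtain c where c: "0 < c" and J: "\<And>x. 0 < x \<Longrightarrow>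
    (\<integral>\<^sup>+t. ennreal (x / (x + t) * t powr (\<alpha> - 1)) * indicator {0<..} t \<partial>lborel) = ennreal (c * x powr \<alpha>)"
    using powr_stieltjes[OF \<alpha>] by blast
  have repr: "ennreal (c * (\<Sum>i\<in>K. f i powr \<alpha> * R i)) =
      (\<integral>\<^sup>+t. ennreal ((\<Sum>i\<in>K. f i / (f i + t) * R i) * t powr (\<alpha> - 1)) * indicator {0<..} t \<partial>lborel)"
    if K: "finite K" "\<And>i. i \<in> K \<Longrightarrow> 0 < f i" "\<And>i. i \<in> K \<Longrightarrow> 0 \<le> R i" for K :: "'k set" and f R :: "'k \<Rightarrow> real"
  proof -
    have "ennreal (c * (\<Sum>i\<in>K. f i powr \<alpha> * R i)) = ennreal (\<Sum>i\<in>K. R i * (c * f i powr \<alpha>))"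
      by (simp add: sum_distrib_left mult_ac)
    also have "\<dots> = (\<Sum>i\<in>K. ennreal (R i) * ennreal (c * f i powr \<alpha>))"
      using K c by (subst sum_ennreal[symmetric]) (auto simp: ennreal_mult)
    also have "\<dots> = (\<Sum>i\<in>K. ennreal (R i) * (\<integral>\<^sup>+t. ennreal (f i / (f i + t) * t powr (\<alpha> - 1)) * indicator {0<..} t \<partial>lborel))"
      using J K by (intro sum.cong) auto
    also have "\<dots> = (\<integral>\<^sup>+t. (\<Sum>i\<in>K. ennreal (R i) * (ennreal (f i / (f i + t) * t powr (\<alpha> - 1)) * indicator {0<..} t)) \<partial>lborel)"
      by (subst nn_integral_sum) (auto simp: nn_integral_cmult)
    also have "\<dots> = (\<integral>\<^sup>+t. ennreal ((\<Sum>i\<in>K. f i / (f i + t) * R i) * t powr (\<alpha> - 1)) * indicator {0<..} t \<partial>lborel)"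
    proof (rule nn_integral_cong)
      fix t :: real
      show "(\<Sum>i\<in>K. ennreal (R i) * (ennreal (f i / (f i + t) * t powr (\<alpha> - 1)) * indicator {0<..} t))
         = ennreal ((\<Sum>i\<in>K. f i / (f i + t) * R i) * t powr (\<alpha> - 1)) * indicator {0<..} t"
      proof (cases "0 < t")
        case True
        have nn: "0 \<le> f i / (f i + t) * t powr (\<alpha> - 1)" if "i \<in> K" for i
          using K(2)[OF that] True by simp
        have "(\<Sum>i\<in>K. ennreal (R i) * ennreal (f i / (f i + t) * t powr (\<alpha> - 1)))
           = (\<Sum>i\<in>K. ennreal (R i * (f i / (f i + t) * t powr (\<alpha> - 1))))"
          using K nn by (intro sum.cong refl ennreal_mult[symmetric]) auto
        also have "\<dots> = ennreal (\<Sum>i\<in>K. R i * (f i / (f i + t) * t powr (\<alpha> - 1)))"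
          by (rule sum_ennreal) (rule mult_nonneg_nonneg[OF K(3) nn])
        also have "(\<Sum>i\<in>K. R i * (f i / (f i + t) * t powr (\<alpha> - 1))) = (\<Sum>i\<in>K. f i / (f i + t) * R i) * t powr (\<alpha> - 1)"
          unfolding sum_distrib_right by (intro sum.cong refl) simp
        finally show ?thesis using True by simp
      qed simp
    qed
    finally show ?thesis .
  qed
  have "ennreal (c * (\<Sum>i\<in>I. e i powr \<alpha> * Q i)) \<le> ennreal (c * (\<Sum>i\<in>I'. e' i powr \<alpha> * Q' i))"
  proof -
    have "ennreal (c * (\<Sum>i\<in>I. e i powr \<alpha> * Q i)) =
        (\<integral>\<^sup>+t. ennreal ((\<Sum>i\<in>I. e i / (e i + t) * Q i) * t powr (\<alpha> - 1)) * indicator {0<..} t \<partial>lborel)"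
      by (rule repr) (use fin e in auto)
    also have "\<dots> \<le> (\<integral>\<^sup>+t. ennreal ((\<Sum>i\<in>I'. e' i / (e' i + t) * Q' i) * t powr (\<alpha> - 1)) * indicator {0<..} t \<partial>lborel)"
      by (rule nn_integral_mono) (use le in \<open>auto simp: indicator_def intro!: ennreal_leI mult_right_mono\<close>)
    also have "\<dots> = ennreal (c * (\<Sum>i\<in>I'. e' i powr \<alpha> * Q' i))"
      by (rule repr[symmetric]) (use fin e' in auto)
    finally show ?thesis .
  qed
  moreover have "0 \<le> c * (\<Sum>i\<in>I'. e' i powr \<alpha> * Q' i)"
    using c e' by (intro mult_nonneg_nonneg sum_nonneg) auto
  ultimately show ?thesis using c by simp
qed

text \<open>The right-hand side, minimized over \<open>p\<close>, is the parallel sum of the forms \<open>e / t \<bar>q\<bar>\<^sup>2\<close> and \<open>\<bar>q\<bar>\<^sup>2\<close>;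
  the minimum is attained at \<open>p = t / (e + t) q\<close>.\<close>

lemma parallel_sum_ge:
  fixes e t :: real and p q :: complex
  assumes "0 < e" "0 < t"
  shows "e / (e + t) * (cmod q)\<^sup>2 \<le> e / t * (cmod p)\<^sup>2 + (cmod (q - p))\<^sup>2"
proof -
  define x where "x = cmod p"
  define y where "y = cmod (q - p)"
  have "cmod q \<le> x + y" unfolding x_def y_def using norm_triangle_ineq[of p "q - p"] by simp
  then have "(cmod q)\<^sup>2 \<le> (x + y)\<^sup>2" by (intro power_mono) auto
  then have "e / (e + t) * (cmod q)\<^sup>2 \<le> e / (e + t) * (x + y)\<^sup>2"
    using assms by (intro mult_left_mono) auto
  also have "\<dots> \<le> e / t * x\<^sup>2 + y\<^sup>2"
  proof -
    have "e / t * x\<^sup>2 + y\<^sup>2 - e / (e + t) * (x + y)\<^sup>2 = (e * x - t * y)\<^sup>2 / (t * (e + t))"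
      using assms by (simp add: field_simps add_pos_pos) (simp add: power2_eq_square algebra_simps)
    then show ?thesis using assms by (smt (verit) divide_nonneg_pos mult_pos_pos zero_le_power2)
  qed
  finally show ?thesis by (simp add: x_def y_def)
qed

text \<open>The exponents 0 and 1 are the hypotheses. For exponents in between it suffices to compare the
  quadratic forms with coefficients \<open>e / (e + t)\<close>. Such a form is the minimum over \<open>y\<close> of
  \<open>\<langle>B y, y\<rangle> / t + \<langle>A (v - y), v - y\<rangle>\<close>, and this expression is monotone in \<open>A\<close> and \<open>B\<close>.\<close>

lemma congruence_mono:
  assumes S: "S \<in> carrier_mat n n"
    and S': "S' \<in> carrier_mat n n" "R' \<in> carrier_mat n n" "R' * S' = 1\<^sub>m n"
    and e: "\<And>i. i < n \<Longrightarrow> 0 < e i" and e': "\<And>i. i < n \<Longrightarrow> 0 < e' i"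
    and A: "\<And>v. v \<in> carrier_vec n \<Longrightarrow> qf (S * dg n (\<lambda>_. 1) * S\<^sup>\<dagger>) v \<le> qf (S' * dg n (\<lambda>_. 1) * S'\<^sup>\<dagger>) v"
    and B: "\<And>v. v \<in> carrier_vec n \<Longrightarrow> qf (S * dg n e * S\<^sup>\<dagger>) v \<le> qf (S' * dg n e' * S'\<^sup>\<dagger>) v"
    and \<alpha>: "0 \<le> \<alpha>" "\<alpha> \<le> 1" and v: "v \<in> carrier_vec n"
  shows "qf (S * dg n (\<lambda>i. e i powr \<alpha>) * S\<^sup>\<dagger>) v \<le> qf (S' * dg n (\<lambda>i. e' i powr \<alpha>) * S'\<^sup>\<dagger>) v"
proof -
  define q where "q = S\<^sup>\<dagger> *\<^sub>v v"
  define q' where "q' = S'\<^sup>\<dagger> *\<^sub>v v"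
  have qc: "q \<in> carrier_vec n" "q' \<in> carrier_vec n" using S S' by (auto simp: q_def q'_def)
  consider "\<alpha> = 0" | "\<alpha> = 1" | "0 < \<alpha>" "\<alpha> < 1" using \<alpha> by linarith
  then show ?thesis
  proof cases
    case 1
    have 0: "x powr \<alpha> = 1" if "0 < x" for x using 1 that by simp
    have "dg n (\<lambda>i. e i powr \<alpha>) = dg n (\<lambda>_. 1)" by (rule dg_cong) (rule 0[OF e])
    moreover have "dg n (\<lambda>i. e' i powr \<alpha>) = dg n (\<lambda>_. 1)" by (rule dg_cong) (rule 0[OF e'])
    ultimately show ?thesis using A[OF v] by (simp only:)
  next
    case 2
    have "dg n (\<lambda>i. e i powr \<alpha>) = dg n e" "dg n (\<lambda>i. e' i powr \<alpha>) = dg n e'"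
      using e e' 2 by (auto intro!: dg_cong simp: less_imp_le)
    then show ?thesis using B[OF v] by simp
  next
    case 3
    have "(\<Sum>i<n. e i / (e i + t) * (cmod (q $ i))\<^sup>2) \<le> (\<Sum>i<n. e' i / (e' i + t) * (cmod (q' $ i))\<^sup>2)"
      if t: "0 < t" for t
    proof -
      \<comment> \<open>The minimizer \<open>y\<close> for the larger pair, given by its coordinates \<open>p'\<close> with respect to \<open>S'\<close>.\<close>
      define p' where "p' = Matrix.vec n (\<lambda>i. of_real (t / (e' i + t)) * q' $ i)"
      define y where "y = R'\<^sup>\<dagger> *\<^sub>v p'"
      have p': "p' \<in> carrier_vec n" by (simp add: p'_def)
      have y: "y \<in> carrier_vec n" using S' by (simp add: y_def)
      have "S'\<^sup>\<dagger> * R'\<^sup>\<dagger> = (R' * S')\<^sup>\<dagger>" using S'(1,2) by (simp add: adj_mult_dim)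
      then have S'R': "S'\<^sup>\<dagger> * R'\<^sup>\<dagger> = 1\<^sub>m n" using S'(3) by simp
      have "S'\<^sup>\<dagger> *\<^sub>v y = (S'\<^sup>\<dagger> * R'\<^sup>\<dagger>) *\<^sub>v p'"
        unfolding y_def by (rule assoc_mult_mat_vec[symmetric]) (use S' p' in auto)
      then have y': "S'\<^sup>\<dagger> *\<^sub>v y = p'" unfolding S'R' using p' by simp
      define p where "p = S\<^sup>\<dagger> *\<^sub>v y"
      have p: "p \<in> carrier_vec n" using S by (simp add: p_def)
      have diff: "M\<^sup>\<dagger> *\<^sub>v (v - y) = M\<^sup>\<dagger> *\<^sub>v v - M\<^sup>\<dagger> *\<^sub>v y" if "M \<in> carrier_mat n n" for M :: "complex mat"
        using mult_minus_distrib_mat_vec[of "M\<^sup>\<dagger>" n n v y] that v y by simp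
      have vy: "v - y \<in> carrier_vec n" using v y by simp
      have "(\<Sum>i<n. e i / (e i + t) * (cmod (q $ i))\<^sup>2)
          \<le> (\<Sum>i<n. e i / t * (cmod (p $ i))\<^sup>2 + (cmod (q $ i - p $ i))\<^sup>2)"
        using e t by (intro sum_mono parallel_sum_ge) auto
      also have "\<dots> = qf (S * dg n e * S\<^sup>\<dagger>) y / t + qf (S * dg n (\<lambda>_. 1) * S\<^sup>\<dagger>) (v - y)"
        unfolding qf_congruence_dg[OF S y] qf_congruence_dg[OF S vy] diff[OF S] p_def[symmetric] q_def[symmetric]
        using p qc by (simp add: sum.distrib sum_divide_distrib)
      also have "\<dots> \<le> qf (S' * dg n e' * S'\<^sup>\<dagger>) y / t + qf (S' * dg n (\<lambda>_. 1) * S'\<^sup>\<dagger>) (v - y)"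
        using t by (intro add_mono divide_right_mono A B y vy) auto
      also have "\<dots> = (\<Sum>i<n. e' i / t * (cmod (p' $ i))\<^sup>2 + (cmod (q' $ i - p' $ i))\<^sup>2)"
        unfolding qf_congruence_dg[OF S'(1) y] qf_congruence_dg[OF S'(1) vy] diff[OF S'(1)] y' q'_def[symmetric]
        using p' qc by (simp add: sum.distrib sum_divide_distrib)
      also have "\<dots> = (\<Sum>i<n. e' i / (e' i + t) * (cmod (q' $ i))\<^sup>2)"
      proof (rule sum.cong)
        fix i assume "i \<in> {..<n}"
        then have i: "i < n" and e0: "0 < e' i" using e' by auto
        define z where "z = e' i + t"
        have z: "0 < z" using e0 t by (simp add: z_def)
        have a: "cmod (p' $ i) = t / z * cmod (q' $ i)"
          using i z t by (simp add: p'_def z_def norm_mult norm_divide del: of_real_add of_real_divide)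
        have "1 - t / z = e' i / z" using z by (simp add: z_def field_simps)
        moreover have "q' $ i - p' $ i = of_real (1 - t / z) * q' $ i"
          using i unfolding p'_def by (simp add: left_diff_distrib z_def)
        ultimately have "q' $ i - p' $ i = of_real (e' i / z) * q' $ i" by simp
        then have b: "cmod (q' $ i - p' $ i) = e' i / z * cmod (q' $ i)"
          using z e0 by (simp add: norm_mult norm_divide)
        have "e' i / t * (t / z)\<^sup>2 + (e' i / z)\<^sup>2 = e' i * (t + e' i) / z\<^sup>2"
          using t z by (simp add: field_simps power2_eq_square)
        also have "\<dots> = e' i / z" using z by (simp add: z_def power2_eq_square add.commute)
        finally have "(e' i / t * (t / z)\<^sup>2 + (e' i / z)\<^sup>2) * (cmod (q' $ i))\<^sup>2 = e' i / z * (cmod (q' $ i))\<^sup>2"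
          by (rule arg_cong)
        then show "e' i / t * (cmod (p' $ i))\<^sup>2 + (cmod (q' $ i - p' $ i))\<^sup>2 = e' i / (e' i + t) * (cmod (q' $ i))\<^sup>2"
          unfolding a b power_mult_distrib z_def[symmetric] by (simp only: distrib_right mult.assoc)
      qed simp
      finally show ?thesis .
    qed
    then show ?thesis
      unfolding qf_congruence_dg[OF S v] qf_congruence_dg[OF S'(1) v] q_def[symmetric] q'_def[symmetric]
      by (intro sum_powr_mono) (use e e' 3 in auto)
  qed
qed

lemma (in power_average) inv_mean_mono:
  assumes A: "pd n A" "pd n A'" and B: "pd n B" "pd n B'"
    and leA: "\<And>v. v \<in> carrier_vec n \<Longrightarrow> qf A v \<le> qf A' v"
    and leB: "\<And>v. v \<in> carrier_vec n \<Longrightarrow> qf B v \<le> qf B' v"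
    and v: "v \<in> carrier_vec n"
  shows "qf (inv_mean h A B) v \<le> qf (inv_mean h A' B') v"
proof -
  have avg: "qf (S * dg n (\<lambda>i. h (e i)) * S\<^sup>\<dagger>) v = (\<integral>\<alpha>. qf (S * dg n (\<lambda>i. e i powr \<alpha>) * S\<^sup>\<dagger>) v \<partial>\<nu>)
      \<and> integrable \<nu> (\<lambda>\<alpha>. qf (S * dg n (\<lambda>i. e i powr \<alpha>) * S\<^sup>\<dagger>) v)"
    if S: "S \<in> carrier_mat n n" and e_pos: "\<forall>i<n. 0 < e i" for S e
  proof -
    have e: "0 < e i" if "i < n" for i using e_pos that by blast
    have int: "integrable \<nu> (\<lambda>\<alpha>. e i powr \<alpha> * (cmod ((S\<^sup>\<dagger> *\<^sub>v v) $ i))\<^sup>2)" if "i < n" for i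
      using integrable_powr[OF e[OF that]] by simp
    have "(\<Sum>i<n. h (e i) * (cmod ((S\<^sup>\<dagger> *\<^sub>v v) $ i))\<^sup>2) = (\<Sum>i<n. \<integral>\<alpha>. e i powr \<alpha> * (cmod ((S\<^sup>\<dagger> *\<^sub>v v) $ i))\<^sup>2 \<partial>\<nu>)"
      by (intro sum.cong refl) (use e h_pos_eq in auto)
    also have "\<dots> = (\<integral>\<alpha>. (\<Sum>i<n. e i powr \<alpha> * (cmod ((S\<^sup>\<dagger> *\<^sub>v v) $ i))\<^sup>2) \<partial>\<nu>)"
      by (rule Bochner_Integration.integral_sum[symmetric]) (use int in auto)
    finally show ?thesis unfolding qf_congruence_dg[OF S v]
      using int by (auto intro!: Bochner_Integration.integrable_sum)
  qed
  obtain S R e where S: "S \<in> carrier_mat n n" "R \<in> carrier_mat n n" "S * R = 1\<^sub>m n" "R * S = 1\<^sub>m n"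
    and e: "\<And>i. i < n \<Longrightarrow> 0 < e i"
    and Aeq: "A = S * dg n (\<lambda>_. 1) * S\<^sup>\<dagger>" and Beq: "B = S * dg n e * S\<^sup>\<dagger>"
    and mean: "\<And>h. inv_mean h A B = S * dg n (\<lambda>i. h (e i)) * S\<^sup>\<dagger>"
    by (rule inv_mean_congruence[OF A(1) B(1)]) (rule that, assumption+)
  obtain S' R' e' where S': "S' \<in> carrier_mat n n" "R' \<in> carrier_mat n n" "S' * R' = 1\<^sub>m n" "R' * S' = 1\<^sub>m n"
    and e': "\<And>i. i < n \<Longrightarrow> 0 < e' i"
    and Aeq': "A' = S' * dg n (\<lambda>_. 1) * S'\<^sup>\<dagger>" and Beq': "B' = S' * dg n e' * S'\<^sup>\<dagger>"
    and mean': "\<And>h. inv_mean h A' B' = S' * dg n (\<lambda>i. h (e' i)) * S'\<^sup>\<dagger>"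
    by (rule inv_mean_congruence[OF A(2) B(2)]) (rule that, assumption+)
  have "qf (S * dg n (\<lambda>i. e i powr \<alpha>) * S\<^sup>\<dagger>) v \<le> qf (S' * dg n (\<lambda>i. e' i powr \<alpha>) * S'\<^sup>\<dagger>) v"
    if "0 \<le> \<alpha>" "\<alpha> \<le> 1" for \<alpha>
    using congruence_mono[OF S(1) S'(1,2,4) e e' leA[unfolded Aeq Aeq'] leB[unfolded Beq Beq'] that v] by blast
  moreover have "\<forall>i<n. 0 < e i" "\<forall>i<n. 0 < e' i" using e e' by blast+
  moreover note av = avg[OF S(1) this(1)] and av' = avg[OF S'(1) this(2)]
  ultimately show ?thesis
    unfolding mean mean' av[THEN conjunct1] av'[THEN conjunct1]
    using av av' by (intro integral_mono) (auto simp: space_measure)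
qed

section \<open>The limit defining the mean of singular matrices\<close>

lemma eigen_decomp_add_eps:
  assumes A: "eigen_decomp n A U d"
  shows "eigen_decomp n (add_eps A \<epsilon>) U (\<lambda>i. d i + \<epsilon>)"
proof -
  have U: "U \<in> carrier_mat n n" "U * U\<^sup>\<dagger> = 1\<^sub>m n" "unitary n U" and Aeq: "A = U * dg n d * U\<^sup>\<dagger>"
    using A by (auto simp: eigen_decomp_def unitary_def)
  have Ac: "A \<in> carrier_mat n n" by (rule eigen_decomp_carrier[OF A])
  have "add_eps A \<epsilon> = U * dg n (\<lambda>i. d i + \<epsilon>) * U\<^sup>\<dagger>"
  proof (rule eq_matI)
    fix i j assume "i < dim_row (U * dg n (\<lambda>i. d i + \<epsilon>) * U\<^sup>\<dagger>)" "j < dim_col (U * dg n (\<lambda>i. d i + \<epsilon>) * U\<^sup>\<dagger>)"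
    then have ij: "i < n" "j < n" using U by auto
    have 1: "(\<Sum>p<n. U $$ (i, p) * cnj (U $$ (j, p))) = (if i = j then 1 else 0)"
      using index_congruence_dg[OF U(1) ij, of "\<lambda>_. 1"] U ij by simp
    have "add_eps A \<epsilon> $$ (i, j) = A $$ (i, j) + of_real \<epsilon> * (if i = j then 1 else 0)"
      using Ac ij by (simp add: add_eps_def)
    also have "\<dots> = (\<Sum>p<n. U $$ (i, p) * of_real (d p + \<epsilon>) * cnj (U $$ (j, p)))"
      unfolding 1[symmetric] unfolding Aeq index_congruence_dg[OF U(1) ij]
      unfolding sum_distrib_left sum.distrib[symmetric]
      by (intro sum.cong refl) (simp add: distrib_left distrib_right)
    also have "\<dots> = (U * dg n (\<lambda>i. d i + \<epsilon>) * U\<^sup>\<dagger>) $$ (i, j)"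
      by (rule index_congruence_dg[OF U(1) ij, symmetric])
    finally show "add_eps A \<epsilon> $$ (i, j) = (U * dg n (\<lambda>i. d i + \<epsilon>) * U\<^sup>\<dagger>) $$ (i, j)" .
  qed (use Ac U in \<open>auto simp: add_eps_def\<close>)
  then show ?thesis using U by (simp add: eigen_decomp_def)
qed

lemma pd_add_eps:
  assumes "psd n A" "0 < \<epsilon>"
  shows "pd n (add_eps A \<epsilon>)"
proof -
  obtain U d where "eigen_decomp n A U d" "\<And>i. i < n \<Longrightarrow> 0 \<le> d i"
    using psd_eigen_decomp[OF assms(1)] by blast
  then show ?thesis using pd_iff_eigen[OF eigen_decomp_add_eps] assms(2) by (metis add_nonneg_pos)
qed

lemma qf_add_eps_mono:
  assumes "psd n A" "\<epsilon> \<le> \<delta>" "v \<in> carrier_vec n"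
  shows "qf (add_eps A \<epsilon>) v \<le> qf (add_eps A \<delta>) v"
proof -
  obtain U d where "eigen_decomp n A U d" using psd_eigen_decomp[OF assms(1)] by blast
  note E = eigen_decomp_add_eps[OF this]
  show ?thesis unfolding qf_eigen[OF E assms(3)]
    using assms(2) by (intro sum_mono mult_right_mono) auto
qed

lemma monotone_bounded_tendsto_at_right:
  fixes f :: "real \<Rightarrow> real"
  assumes mono: "\<And>x y. 0 < x \<Longrightarrow> x \<le> y \<Longrightarrow> f x \<le> f y" and bdd: "\<And>x. 0 < x \<Longrightarrow> b \<le> f x"
  shows "\<exists>l. (f \<longlongrightarrow> l) (at_right 0)"
proof -
  define l where "l = Inf (f ` {0<..})"
  have bb: "bdd_below (f ` {0<..})" using bdd by (auto intro!: bdd_belowI)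
  have ne: "f ` {0<..} \<noteq> {}" by auto
  have "(f \<longlongrightarrow> l) (at_right 0)"
  proof (rule order_tendstoI)
    fix a assume "a < l"
    then have "a < f x" if "0 < x" for x
      using cInf_lower[OF _ bb, of "f x"] that unfolding l_def by fastforce
    then show "\<forall>\<^sub>F x in at_right 0. a < f x"
      by (simp add: eventually_at_right_less eventually_mono[OF eventually_at_right_less[of 0]])
  next
    fix a assume "l < a"
    then obtain y where y: "0 < y" "f y < a"
      using cInf_less_iff[OF ne bb] by (auto simp: l_def)
    then have "f x < a" if "0 < x" "x < y" for x using mono[of x y] that by simp
    then show "\<forall>\<^sub>F x in at_right 0. f x < a"
      unfolding eventually_at_right_field using y(1) by blast
  qed
  then show ?thesis ..
qed

lemma qf_add_smult:
  assumes M: "M \<in> carrier_mat n n" "M\<^sup>\<dagger> = M" and u: "u \<in> carrier_vec n" and w: "w \<in> carrier_vec n"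
  shows "qf M (u + z \<cdot>\<^sub>v w) = qf M u + (cmod z)\<^sup>2 * qf M w + 2 * Re (z * ((M *\<^sub>v w) \<bullet>c u))"
proof -
  define a where "a = M *\<^sub>v u"
  define b where "b = M *\<^sub>v w"
  have ab: "a \<in> carrier_vec n" "b \<in> carrier_vec n" using M by (auto simp: a_def b_def)
  have "M *\<^sub>v (u + z \<cdot>\<^sub>v w) = a + z \<cdot>\<^sub>v b"
    using mult_add_distrib_mat_vec[OF M(1) u, of "z \<cdot>\<^sub>v w"] mult_mat_vec[OF M(1) w, of z] w by (simp add: a_def b_def)
  then have "(M *\<^sub>v (u + z \<cdot>\<^sub>v w)) \<bullet>c (u + z \<cdot>\<^sub>v w)
      = (\<Sum>i<n. (a $ i + z * b $ i) * cnj (u $ i + z * w $ i))"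
    using ab u w by (simp add: cscalar_sum[of _ n])
  also have "\<dots> = (\<Sum>i<n. a $ i * cnj (u $ i)) + z * cnj z * (\<Sum>i<n. b $ i * cnj (w $ i))
       + (z * (\<Sum>i<n. b $ i * cnj (u $ i)) + cnj z * (\<Sum>i<n. a $ i * cnj (w $ i)))"
    unfolding sum_distrib_left sum.distrib[symmetric]
    by (intro sum.cong refl) (simp add: distrib_left distrib_right)
  also have "(\<Sum>i<n. a $ i * cnj (u $ i)) = a \<bullet>c u" using ab u by (simp add: cscalar_sum[of _ n])
  also have "(\<Sum>i<n. b $ i * cnj (w $ i)) = b \<bullet>c w" using ab w by (simp add: cscalar_sum[of _ n])
  also have "(\<Sum>i<n. b $ i * cnj (u $ i)) = b \<bullet>c u" using ab u by (simp add: cscalar_sum[of _ n])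
  also have "(\<Sum>i<n. a $ i * cnj (w $ i)) = cnj (b \<bullet>c u)"
  proof -
    have "(\<Sum>i<n. a $ i * cnj (w $ i)) = a \<bullet>c w" using ab w by (simp add: cscalar_sum[of _ n])
    also have "\<dots> = u \<bullet>c b" unfolding a_def b_def using adj_inner[OF M(1) u w] M(2) by simp
    also have "\<dots> = cnj (b \<bullet>c u)" using ab u by (simp add: cscalar_sum[of _ n] mult.commute)
    finally show ?thesis .
  qed
  also have "z * (b \<bullet>c u) + cnj z * cnj (b \<bullet>c u) = of_real (2 * Re (z * (b \<bullet>c u)))"
    using complex_add_cnj[of "z * (b \<bullet>c u)"] by simp
  also have "z * cnj z = of_real ((cmod z)\<^sup>2)" by (simp only: complex_norm_square)
  finally show ?thesis unfolding qf_def a_def b_def by simp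
qed

text \<open>Monotonicity makes quadratic forms converge, but the mean is defined by limits of entries. Polarization
  connects the two.\<close>

lemma hermitian_entry_polarization:
  assumes M: "M \<in> carrier_mat n n" "M\<^sup>\<dagger> = M" and ij: "i < n" "j < n"
  shows "M $$ (i, j) = Complex
    ((qf M (unit_vec n i + 1 \<cdot>\<^sub>v unit_vec n j) - qf M (unit_vec n i) - qf M (unit_vec n j)) / 2)
    (- (qf M (unit_vec n i + \<i> \<cdot>\<^sub>v unit_vec n j) - qf M (unit_vec n i) - qf M (unit_vec n j)) / 2)"
proof -
  have "(M *\<^sub>v unit_vec n j) \<bullet>c unit_vec n i = M $$ (i, j)"
  proof -
    have col: "M *\<^sub>v unit_vec n j \<in> carrier_vec n" "(M *\<^sub>v unit_vec n j) $ i = M $$ (i, j)"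
      using M ij by auto
    have "(M *\<^sub>v unit_vec n j) \<bullet>c unit_vec n i = (\<Sum>p<n. (M *\<^sub>v unit_vec n j) $ p * (if p = i then 1 else 0))"
      using col by (subst cscalar_sum[of _ n]) (auto intro!: sum.cong simp: unit_vec_def simp del: index_mult_mat_vec)
    also have "\<dots> = (M *\<^sub>v unit_vec n j) $ i"
      using ij by (simp add: if_distrib[of "\<lambda>x. _ * x"] sum.delta' cong: if_cong del: index_mult_mat_vec)
    finally show ?thesis using col by simp
  qed
  then show ?thesis
    using qf_add_smult[OF M, of "unit_vec n i" "unit_vec n j" 1]
      qf_add_smult[OF M, of "unit_vec n i" "unit_vec n j" \<i>]
    by (intro complex_eqI) auto
qed

lemma tendsto_qf:
  assumes G: "\<forall>\<^sub>F x in F. G x \<in> carrier_mat n n" and L: "L \<in> carrier_mat n n" and v: "v \<in> carrier_vec n"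
    and lim: "\<And>i j. i < n \<Longrightarrow> j < n \<Longrightarrow> ((\<lambda>x. G x $$ (i, j)) \<longlongrightarrow> L $$ (i, j)) F"
  shows "((\<lambda>x. qf (G x) v) \<longlongrightarrow> qf L v) F"
proof -
  have eq: "qf M v = Re (\<Sum>i<n. (\<Sum>j<n. M $$ (i, j) * v $ j) * cnj (v $ i))" if "M \<in> carrier_mat n n" for M
    unfolding qf_def using that v
    by (subst cscalar_sum[of _ n]) (auto simp: index_mult_vec_sum[OF that v] simp del: index_mult_mat_vec)
  have "((\<lambda>x. Re (\<Sum>i<n. (\<Sum>j<n. G x $$ (i, j) * v $ j) * cnj (v $ i))) \<longlongrightarrow> qf L v) F"
    unfolding eq[OF L] by (intro tendsto_intros lim) auto
  then show ?thesis
    by (rule Lim_transform_eventually) (use G eq in \<open>auto elim!: eventually_mono\<close>)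
qed

context power_average
begin

text \<open>As \<open>\<epsilon>\<close> decreases to 0, the quadratic forms of the means of \<open>A + \<epsilon>\<close> and \<open>B + \<epsilon>\<close> decrease and remain
  nonnegative. The convergence is needed to evaluate the operator \<^const>\<open>Lim\<close>, which is unspecified for
  divergent functions.\<close>

lemma eps_mean_tendsto:
  assumes A: "psd n A" and B: "psd n B"
  defines "G \<equiv> \<lambda>\<epsilon>. inv_mean h (add_eps A \<epsilon>) (add_eps B \<epsilon>)"
  obtains L where "L \<in> carrier_mat n n" "L\<^sup>\<dagger> = L"
    "\<And>i j. i < n \<Longrightarrow> j < n \<Longrightarrow> ((\<lambda>\<epsilon>. G \<epsilon> $$ (i, j)) \<longlongrightarrow> L $$ (i, j)) (at_right 0)"
proof -
  have G: "pd n (G \<epsilon>)" if "0 < \<epsilon>" for \<epsilon>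
    unfolding G_def by (intro pd_inv_mean pd_add_eps A B that)
  have "\<exists>l. ((\<lambda>\<epsilon>. qf (G \<epsilon>) v) \<longlongrightarrow> l) (at_right 0)" if v: "v \<in> carrier_vec n" for v
  proof (rule monotone_bounded_tendsto_at_right)
    fix x y :: real assume "0 < x" "x \<le> y"
    then show "qf (G x) v \<le> qf (G y) v"
      unfolding G_def using A B v by (intro inv_mean_mono[of n] pd_add_eps qf_add_eps_mono) auto
  next
    fix x :: real assume "0 < x"
    then obtain U d where "eigen_decomp n (G x) U d" "\<And>i. i < n \<Longrightarrow> 0 < d i"
      using pd_eigen_decomp[OF G] by metis
    then show "0 \<le> qf (G x) v"
      by (subst qf_eigen[OF _ v]) (auto intro!: sum_nonneg mult_nonneg_nonneg simp: less_imp_le)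
  qed
  then obtain l where l: "\<And>v. v \<in> carrier_vec n \<Longrightarrow> ((\<lambda>\<epsilon>. qf (G \<epsilon>) v) \<longlongrightarrow> l v) (at_right 0)"
    by metis
  have entry: "\<exists>m. ((\<lambda>\<epsilon>. G \<epsilon> $$ (i, j)) \<longlongrightarrow> m) (at_right 0)" if ij: "i < n" "j < n" for i j
  proof -
    let ?e = "unit_vec n :: nat \<Rightarrow> complex vec"
    let ?p = "\<lambda>\<epsilon>. Complex
      ((qf (G \<epsilon>) (?e i + 1 \<cdot>\<^sub>v ?e j) - qf (G \<epsilon>) (?e i) - qf (G \<epsilon>) (?e j)) / 2)
      (- (qf (G \<epsilon>) (?e i + \<i> \<cdot>\<^sub>v ?e j) - qf (G \<epsilon>) (?e i) - qf (G \<epsilon>) (?e j)) / 2)"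
    let ?l = "Complex ((l (?e i + 1 \<cdot>\<^sub>v ?e j) - l (?e i) - l (?e j)) / 2)
       (- (l (?e i + \<i> \<cdot>\<^sub>v ?e j) - l (?e i) - l (?e j)) / 2)"
    have "(?p \<longlongrightarrow> ?l) (at_right 0)"
      by (intro tendsto_intros l) auto
    moreover have "\<forall>\<^sub>F \<epsilon> in at_right 0. ?p \<epsilon> = G \<epsilon> $$ (i, j)"
      using eventually_at_right_less[of 0]
    proof eventually_elim
      case (elim \<epsilon>)
      then show ?case using hermitian_entry_polarization[of "G \<epsilon>" n i j] G ij by (simp add: pd_def)
    qed
    ultimately have "((\<lambda>\<epsilon>. G \<epsilon> $$ (i, j)) \<longlongrightarrow> ?l) (at_right 0)"
      by (rule Lim_transform_eventually)
    then show ?thesis ..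
  qed
  then obtain m where m: "\<And>i j. i < n \<Longrightarrow> j < n \<Longrightarrow> ((\<lambda>\<epsilon>. G \<epsilon> $$ (i, j)) \<longlongrightarrow> m i j) (at_right 0)"
    by metis
  define L where "L = Matrix.mat n n (\<lambda>(i, j). m i j)"
  have "L\<^sup>\<dagger> = L"
  proof (rule eq_matI)
    fix i j assume "i < dim_row L" "j < dim_col L"
    then have ij: "i < n" "j < n" by (auto simp: L_def)
    have "((\<lambda>\<epsilon>. cnj (G \<epsilon> $$ (j, i))) \<longlongrightarrow> cnj (m j i)) (at_right 0)"
      by (intro tendsto_intros m ij)
    moreover have "\<forall>\<^sub>F \<epsilon> in at_right 0. cnj (G \<epsilon> $$ (j, i)) = G \<epsilon> $$ (i, j)"
      using eventually_at_right_less[of 0]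
    proof eventually_elim
      case (elim \<epsilon>)
      then have "G \<epsilon> \<in> carrier_mat n n" "(G \<epsilon>)\<^sup>\<dagger> = G \<epsilon>" using G by (auto simp: pd_def)
      then show ?case using ij adj_index[of i "G \<epsilon>" j] by auto
    qed
    ultimately have "((\<lambda>\<epsilon>. G \<epsilon> $$ (i, j)) \<longlongrightarrow> cnj (m j i)) (at_right 0)"
      by (rule Lim_transform_eventually)
    then have "cnj (m j i) = m i j" using m[OF ij] by (rule tendsto_unique[rotated]) simp
    then show "L\<^sup>\<dagger> $$ (i, j) = L $$ (i, j)" using ij by (simp add: L_def)
  qed (simp_all add: L_def)
  then show ?thesis using that[of L] m by (simp add: L_def)
qed

lemma mean_mono:
  assumes "0 < x" "x \<le> x'" "0 < y" "y \<le> y'"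
  shows "x * h (y / x) \<le> x' * h (y' / x')"
proof -
  have eq: "x * h (y / x) = (\<integral>\<alpha>. x * (y / x) powr \<alpha> \<partial>\<nu>)" if "0 < x" "0 < y" for x y
    using h_pos_eq[of "y / x"] that by simp
  have "x * (y / x) powr \<alpha> \<le> x' * (y' / x') powr \<alpha>" if "0 \<le> \<alpha>" "\<alpha> \<le> 1" for \<alpha>
  proof -
    have "u * (w / u) powr \<alpha> = u powr (1 - \<alpha>) * w powr \<alpha>" if "0 < u" "0 < w" for u w
      using that by (simp add: powr_divide powr_diff)
    moreover have "x powr (1 - \<alpha>) * y powr \<alpha> \<le> x' powr (1 - \<alpha>) * y' powr \<alpha>"
      using assms that by (intro mult_mono powr_mono2) auto
    ultimately show ?thesis using assms by simp
  qed
  then have "(\<integral>\<alpha>. x * (y / x) powr \<alpha> \<partial>\<nu>) \<le> (\<integral>\<alpha>. x' * (y' / x') powr \<alpha> \<partial>\<nu>)"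
    using assms by (intro integral_mono integrable_mult_right integrable_powr) (auto simp: space_measure)
  then show ?thesis using assms eq[of x y] eq[of x' y'] by linarith
qed

end

section \<open>Means of scalars\<close>

lemma scalar_mat_eigen: "eigen_decomp 1 (scalar_mat x) (1\<^sub>m 1) (\<lambda>_. x)"
  unfolding eigen_decomp_def by (auto intro!: eq_matI simp: scalar_mat_def mat_diag_def)

lemma fun_calc_scalar: "fun_calc f (scalar_mat x) = scalar_mat (f x)"
  using fun_calc_eq[OF scalar_mat_eigen, of f x] scalar_mat_eigen[of "f x"] by (simp add: eigen_decomp_def)

lemma scalar_mat_mult: "scalar_mat x * scalar_mat y = scalar_mat (x * y)"
  by (rule eq_matI) (auto simp: scalar_mat_def scalar_prod_def)

lemma inv_mean_scalar:
  assumes "0 < x" "0 < y"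
  shows "inv_mean h (scalar_mat x) (scalar_mat y) = scalar_mat (x * h (y / x))"
proof -
  have 1: "x powr (-1/2) * y * x powr (-1/2) = y / x"
  proof -
    have "x powr (-1/2) * x powr (-1/2) = x powr (-1)" by (simp add: powr_add[symmetric])
    then show ?thesis using assms by (simp add: powr_minus_divide mult.assoc mult.commute[of y])
  qed
  have 2: "sqrt x * h (y / x) * sqrt x = x * h (y / x)"
    using assms by (simp add: mult.assoc mult.commute[of "h _"] flip: mult.assoc)
  show ?thesis unfolding inv_mean_def fun_calc_scalar scalar_mat_mult 1 2 ..
qed

lemma add_eps_scalar: "add_eps (scalar_mat x) \<epsilon> = scalar_mat (x + \<epsilon>)"
  by (rule eq_matI) (auto simp: add_eps_def scalar_mat_def)

lemma invertible_scalar: "invertible_mat (scalar_mat x) \<longleftrightarrow> x \<noteq> 0"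
  using invertible_iff_det[of "scalar_mat x" 1] det_eigen[OF scalar_mat_eigen, of x]
  by (simp add: scalar_mat_def)

lemma psd_scalar: "0 \<le> x \<Longrightarrow> psd 1 (scalar_mat x)"
  using eigen_decomp_hermitian[OF scalar_mat_eigen[of x]] eigen_decomp_carrier(2)[OF scalar_mat_eigen[of x]]
  by (auto simp: psd_def scalar_mat_def scalar_prod_def less_eq_complex_def complex_mult_cnj mult.assoc)

lemma root_prod_le_mean:
  assumes "1 \<le> k" "\<And>i. i < k \<Longrightarrow> 0 \<le> x i"
  shows "root k (\<Prod>i<k. x i) \<le> (\<Sum>i<k. x i) / k"
proof -
  have "0 \<in> {..<k}" using assms(1) by simp
  then have "(\<Prod>i<k. x i) powr (1 / k) \<le> (\<Sum>i<k. x i / k)"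
    using arith_geom_mean[of "{..<k}" x] assms by force
  moreover have "root k (\<Prod>i<k. x i) = (\<Prod>i<k. x i) powr (1 / k)"
    by (rule root_powr_inverse) (use assms in \<open>auto intro: prod_nonneg\<close>)
  ultimately show ?thesis by (simp add: sum_divide_distrib)
qed

text \<open>Superadditivity of the geometric mean: after division by the right-hand side, the two terms on the left
  are geometric means of \<open>a\<^sub>i / (a\<^sub>i + \<epsilon>)\<close> and of \<open>\<epsilon> / (a\<^sub>i + \<epsilon>)\<close>, and the corresponding arithmetic means
  add up to 1.\<close>

lemma root_prod_add_ge:
  fixes a :: "nat \<Rightarrow> real"
  assumes k: "1 \<le> k" and a: "\<And>i. i < k \<Longrightarrow> 0 \<le> a i" and \<epsilon>: "0 < \<epsilon>"
  shows "root k (\<Prod>i<k. a i) + \<epsilon> \<le> root k (\<Prod>i<k. a i + \<epsilon>)"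
proof -
  define r where "r = root k (\<Prod>i<k. a i + \<epsilon>)"
  have ae: "0 < a i + \<epsilon>" if "i < k" for i using a[OF that] \<epsilon> by simp
  then have "0 < (\<Prod>i<k. a i + \<epsilon>)" by (intro prod_pos) auto
  then have r: "0 < r" using k by (simp add: r_def)
  have "root k (\<Prod>i<k. a i) / r = root k (\<Prod>i<k. a i / (a i + \<epsilon>))"
    by (simp add: r_def prod_dividef real_root_divide)
  also have "\<dots> \<le> (\<Sum>i<k. a i / (a i + \<epsilon>)) / k"
    by (rule root_prod_le_mean[OF k]) (use a ae in \<open>auto simp: less_imp_le\<close>)
  finally have 1: "root k (\<Prod>i<k. a i) / r \<le> (\<Sum>i<k. a i / (a i + \<epsilon>)) / k" .
  have "\<epsilon> / r = root k (\<Prod>i<k. \<epsilon> / (a i + \<epsilon>))"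
    using k \<epsilon> by (simp add: r_def prod_dividef real_root_divide real_root_power_cancel)
  also have "\<dots> \<le> (\<Sum>i<k. \<epsilon> / (a i + \<epsilon>)) / k"
    by (rule root_prod_le_mean[OF k]) (use \<epsilon> ae in \<open>auto simp: less_imp_le\<close>)
  finally have 2: "\<epsilon> / r \<le> (\<Sum>i<k. \<epsilon> / (a i + \<epsilon>)) / k" .
  have "(\<Sum>i<k. a i / (a i + \<epsilon>)) + (\<Sum>i<k. \<epsilon> / (a i + \<epsilon>)) = (\<Sum>i<k. 1)"
    unfolding sum.distrib[symmetric]
  proof (intro sum.cong refl)
    fix i assume "i \<in> {..<k}"
    then have "a i + \<epsilon> \<noteq> 0" using ae[of i] by simp
    then show "a i / (a i + \<epsilon>) + \<epsilon> / (a i + \<epsilon>) = 1" by (simp add: add_divide_distrib[symmetric])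
  qed
  then have "(\<Sum>i<k. a i / (a i + \<epsilon>)) / k + (\<Sum>i<k. \<epsilon> / (a i + \<epsilon>)) / k = 1"
    using k by (simp add: add_divide_distrib[symmetric])
  then have "(root k (\<Prod>i<k. a i) + \<epsilon>) / r \<le> 1" using 1 2 by (simp add: add_divide_distrib)
  then show ?thesis using r by (simp add: r_def)
qed

text \<open>A product of at least one of the smallest eigenvalues vanishes exactly if the matrix is singular.
  Therefore the mean of two matrices and the mean of the corresponding scalars are given by the explicit
  formula in the same cases, and by the limit in the same cases.\<close>

lemma invertible_iff_prod_smallest_pos:
  assumes A: "eigen_decomp n A U d" "mono_on {..<n} d" "\<And>i. i < n \<Longrightarrow> 0 \<le> d i" and k: "1 \<le> k" "k \<le> n"
  shows "invertible_mat A \<longleftrightarrow> 0 < (\<Prod>i<k. d i)" "invertible_mat A \<longleftrightarrow> (\<forall>i<n. 0 < d i)"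
proof -
  have inv: "invertible_mat A \<longleftrightarrow> (\<Prod>i<n. d i) \<noteq> 0"
    using invertible_iff_det[OF eigen_decomp_carrier(2)[OF A(1)]] det_eigen[OF A(1)] by simp
  show 1: "invertible_mat A \<longleftrightarrow> (\<forall>i<n. 0 < d i)"
    unfolding inv using A(3) by (auto simp: less_le)
  have "0 < d i" if "0 < d 0" "i < n" for i
    using mono_onD[OF A(2), of 0 i] that by simp
  moreover have "0 < d 0" if "0 < (\<Prod>i<k. d i)"
  proof -
    have "d 0 \<noteq> 0" using that k by (auto simp: prod_zero_iff less_le)
    then show ?thesis using A(3)[of 0] k by simp
  qed
  moreover have "0 < (\<Prod>i<k. d i)" if "\<forall>i<n. 0 < d i" using that k by (intro prod_pos) auto
  ultimately show "invertible_mat A \<longleftrightarrow> 0 < (\<Prod>i<k. d i)" unfolding 1 by blast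
qed

context power_average
begin

lemma scalar_mean_pos:
  assumes "0 < a" "0 < b"
  shows "scalar_mean h a b = a * h (b / a)"
  using assms by (simp add: scalar_mean_def op_mean_def invertible_scalar inv_mean_scalar) (simp add: scalar_mat_def)

lemma scalar_mean_tendsto:
  assumes "0 \<le> a" "0 \<le> b" "a = 0 \<or> b = 0"
  shows "((\<lambda>\<epsilon>. (a + \<epsilon>) * h ((b + \<epsilon>) / (a + \<epsilon>))) \<longlongrightarrow> scalar_mean h a b) (at_right 0)"
proof -
  define F where "F \<epsilon> = inv_mean h (add_eps (scalar_mat a) \<epsilon>) (add_eps (scalar_mat b) \<epsilon>) $$ (0, 0)" for \<epsilon>
  obtain L where L: "(F \<longlongrightarrow> L $$ (0, 0)) (at_right 0)"
    using eps_mean_tendsto[OF psd_scalar[OF assms(1)] psd_scalar[OF assms(2)]] unfolding F_def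
    by (metis less_one)
  have dim: "dim_row (scalar_mat a) = 1" by (simp add: scalar_mat_def)
  have "\<not> (invertible_mat (scalar_mat a) \<and> invertible_mat (scalar_mat b))"
    using assms(3) by (auto simp: invertible_scalar)
  then have "scalar_mean h a b = Re (Lim (at_right 0) F)"
    unfolding scalar_mean_def op_mean_def dim F_def[abs_def] by auto
  also have "Lim (at_right 0) F = L $$ (0, 0)" by (rule tendsto_Lim[OF _ L]) simp
  finally have "((\<lambda>\<epsilon>. Re (F \<epsilon>)) \<longlongrightarrow> scalar_mean h a b) (at_right 0)"
    using tendsto_Re[OF L] by simp
  moreover have "\<forall>\<^sub>F \<epsilon> in at_right 0. Re (F \<epsilon>) = (a + \<epsilon>) * h ((b + \<epsilon>) / (a + \<epsilon>))"
    using eventually_at_right_less[of 0]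
  proof eventually_elim
    case (elim \<epsilon>)
    then have "F \<epsilon> = scalar_mat ((a + \<epsilon>) * h ((b + \<epsilon>) / (a + \<epsilon>))) $$ (0, 0)"
      unfolding F_def add_eps_scalar using assms by (subst inv_mean_scalar) auto
    then show ?case by (simp add: scalar_mat_def)
  qed
  ultimately show ?thesis by (rule Lim_transform_eventually)
qed

text \<open>In the singular case the vectors are fixed as the eigenvectors of the limit \<open>L\<close>. Along them the products
  of quadratic forms of the approximating means converge to the product of the smallest eigenvalues of
  \<open>L\<close>, and they dominate the scalar means: by superadditivity of the geometric mean, adding \<open>\<epsilon>\<close> to a
  matrix raises the geometric mean of its \<open>k\<close> smallest eigenvalues by at least \<open>\<epsilon>\<close>.\<close>

lemma smallest_op_mean_ge:
  assumes A: "psd n A" and B: "psd n B" and k: "1 \<le> k" "k \<le> n"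
  shows "scalar_mean h (root k (\<Prod>j = n + 1 - k..n. sing_val j A)) (root k (\<Prod>j = n + 1 - k..n. sing_val j B))
    \<le> root k (\<Prod>j = n + 1 - k..n. sing_val j (op_mean h A B))"
proof -
  obtain UA a where a: "eigen_decomp n A UA a" "mono_on {..<n} a" "\<And>i. i < n \<Longrightarrow> 0 \<le> a i"
    using psd_eigen_decomp[OF A] by blast
  obtain UB b where b: "eigen_decomp n B UB b" "mono_on {..<n} b" "\<And>i. i < n \<Longrightarrow> 0 \<le> b i"
    using psd_eigen_decomp[OF B] by blast
  define a' where "a' = root k (\<Prod>i<k. a i)"
  define b' where "b' = root k (\<Prod>i<k. b i)"
  have a'0: "0 \<le> a'" and b'0: "0 \<le> b'"
    unfolding a'_def b'_def using a(3) b(3) k by (auto intro!: real_root_ge_zero prod_nonneg)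
  have inv: "invertible_mat A \<longleftrightarrow> 0 < a'" "invertible_mat B \<longleftrightarrow> 0 < b'"
    using invertible_iff_prod_smallest_pos(1)[OF a k] invertible_iff_prod_smallest_pos(1)[OF b k] k
    by (auto simp: a'_def b'_def)
  have sv: "root k (\<Prod>j = n + 1 - k..n. sing_val j A) = a'" "root k (\<Prod>j = n + 1 - k..n. sing_val j B) = b'"
    using prod_sing_val_eigen[OF a k(2)] prod_sing_val_eigen[OF b k(2)] by (simp_all only: a'_def b'_def)
  show ?thesis
  proof (cases "invertible_mat A \<and> invertible_mat B")
    case True
    then have pos: "\<And>i. i < n \<Longrightarrow> 0 < a i" "\<And>i. i < n \<Longrightarrow> 0 < b i"
      using invertible_iff_prod_smallest_pos(2)[OF a k] invertible_iff_prod_smallest_pos(2)[OF b k] by auto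
    then have "pd n A" "pd n B" using pd_iff_eigen[OF a(1)] pd_iff_eigen[OF b(1)] by auto
    then obtain U c where c: "eigen_decomp n (inv_mean h A B) U c" "mono_on {..<n} c" "\<And>i. i < n \<Longrightarrow> 0 < c i"
      using pd_eigen_decomp[OF pd_inv_mean] by blast
    have "op_mean h A B = inv_mean h A B" using True by (simp add: op_mean_def)
    then have "(\<Prod>j = n + 1 - k..n. sing_val j (op_mean h A B)) = (\<Prod>i<k. c i)"
      using prod_sing_val_eigen[OF c(1,2) less_imp_le[OF c(3)] k(2)] by simp
    moreover have "a' * h (b' / a') \<le> root k (\<Prod>i<k. c i)"
      unfolding a'_def b'_def by (rule smallest_inv_mean_ge[OF a(1,2) pos(1) b(1,2) pos(2) c(1) c(3) k])
    ultimately show ?thesis unfolding sv using scalar_mean_pos True inv by simp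
  next
    case False
    define G where "G \<epsilon> = inv_mean h (add_eps A \<epsilon>) (add_eps B \<epsilon>)" for \<epsilon>
    obtain L where L: "L \<in> carrier_mat n n" "L\<^sup>\<dagger> = L"
      and lim: "\<And>i j. i < n \<Longrightarrow> j < n \<Longrightarrow> ((\<lambda>\<epsilon>. G \<epsilon> $$ (i, j)) \<longlongrightarrow> L $$ (i, j)) (at_right 0)"
      using eps_mean_tendsto[OF A B] unfolding G_def by blast
    have "op_mean h A B = L"
    proof (rule eq_matI)
      fix i j assume "i < dim_row L" "j < dim_col L"
      then have ij: "i < n" "j < n" using L by auto
      then have "op_mean h A B $$ (i, j) = Lim (at_right 0) (\<lambda>\<epsilon>. G \<epsilon> $$ (i, j))"
        using False A by (auto simp: op_mean_def G_def psd_def)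
      also have "\<dots> = L $$ (i, j)" by (rule tendsto_Lim[OF _ lim[OF ij]]) simp
      finally show "op_mean h A B $$ (i, j) = L $$ (i, j)" .
    qed (use False A L in \<open>auto simp: op_mean_def psd_def\<close>)
    obtain U c where c: "eigen_decomp n L U c" "mono_on {..<n} c"
      using hermitian_eigen_decomp[OF L] eigen_decomp_sort by blast
    have Gpd: "pd n (G \<epsilon>)" if "0 < \<epsilon>" for \<epsilon>
      unfolding G_def by (intro pd_inv_mean pd_add_eps A B that)
    have colU: "col U j \<in> carrier_vec n" "col U j \<noteq> 0\<^sub>v n" "qf L (col U j) = c j" if "j < n" for j
      using qf_eigenvector[OF c(1) that] by auto
    have qf_lim: "((\<lambda>\<epsilon>. qf (G \<epsilon>) (col U j)) \<longlongrightarrow> c j) (at_right 0)" if "j < n" for j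
    proof -
      have "\<forall>\<^sub>F \<epsilon> in at_right 0. G \<epsilon> \<in> carrier_mat n n"
        using eventually_at_right_less[of 0] by eventually_elim (use Gpd in \<open>auto simp: pd_def\<close>)
      then show ?thesis using tendsto_qf[OF _ L(1) colU(1)[OF that] lim] colU(3)[OF that] by simp
    qed
    have c0: "0 \<le> c j" if "j < n" for j
    proof (rule tendsto_lowerbound[OF qf_lim[OF that]])
      show "\<forall>\<^sub>F \<epsilon> in at_right 0. 0 \<le> qf (G \<epsilon>) (col U j)"
        using eventually_at_right_less[of 0]
        by eventually_elim (use Gpd colU[OF that] in \<open>auto simp: pd_def less_imp_le\<close>)
    qed simp
    have "((\<lambda>\<epsilon>. root k (\<Prod>j<k. qf (G \<epsilon>) (col U j))) \<longlongrightarrow> root k (\<Prod>j<k. c j)) (at_right 0)"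
      by (intro tendsto_intros qf_lim) (use k in auto)
    moreover have "((\<lambda>\<epsilon>. (a' + \<epsilon>) * h ((b' + \<epsilon>) / (a' + \<epsilon>))) \<longlongrightarrow> scalar_mean h a' b') (at_right 0)"
      using scalar_mean_tendsto[OF a'0 b'0] False inv a'0 b'0 by force
    moreover have "\<forall>\<^sub>F \<epsilon> in at_right 0.
        (a' + \<epsilon>) * h ((b' + \<epsilon>) / (a' + \<epsilon>)) \<le> root k (\<Prod>j<k. qf (G \<epsilon>) (col U j))"
      using eventually_at_right_less[of 0]
    proof eventually_elim
      case (elim \<epsilon>)
      note A\<epsilon> = eigen_decomp_add_eps[OF a(1), of \<epsilon>] and B\<epsilon> = eigen_decomp_add_eps[OF b(1), of \<epsilon>]
      obtain W d where d: "eigen_decomp n (G \<epsilon>) W d" "mono_on {..<n} d" "\<And>i. i < n \<Longrightarrow> 0 < d i"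
        using pd_eigen_decomp[OF Gpd[OF elim]] by blast
      define a\<epsilon> where "a\<epsilon> = root k (\<Prod>i<k. a i + \<epsilon>)"
      define b\<epsilon> where "b\<epsilon> = root k (\<Prod>i<k. b i + \<epsilon>)"
      have "a' + \<epsilon> \<le> a\<epsilon>" unfolding a'_def a\<epsilon>_def using a(3) k elim by (intro root_prod_add_ge) auto
      moreover have "b' + \<epsilon> \<le> b\<epsilon>" unfolding b'_def b\<epsilon>_def using b(3) k elim by (intro root_prod_add_ge) auto
      ultimately have "(a' + \<epsilon>) * h ((b' + \<epsilon>) / (a' + \<epsilon>)) \<le> a\<epsilon> * h (b\<epsilon> / a\<epsilon>)"
        using a'0 b'0 elim by (intro mean_mono) auto
      also have "\<dots> \<le> root k (\<Prod>i<k. d i)"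
        unfolding a\<epsilon>_def b\<epsilon>_def
      proof (rule smallest_inv_mean_ge[OF A\<epsilon> _ _ B\<epsilon> _ _ _ d(3) k])
        show "mono_on {..<n} (\<lambda>i. a i + \<epsilon>)" "mono_on {..<n} (\<lambda>i. b i + \<epsilon>)"
          using a(2) b(2) by (auto simp: mono_on_def)
        show "0 < a i + \<epsilon>" "0 < b i + \<epsilon>" if "i < n" for i
          using a(3)[OF that] b(3)[OF that] elim by auto
        show "eigen_decomp n (inv_mean h (add_eps A \<epsilon>) (add_eps B \<epsilon>)) W d" using d(1) by (simp add: G_def)
      qed
      also have "\<dots> \<le> root k (\<Prod>j<k. qf (G \<epsilon>) (col U j))"
        using prod_smallest_le_prod_qf[OF d _ k(2), of U] c(1) k by (simp add: eigen_decomp_def)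
      finally show ?case .
    qed
    ultimately have "scalar_mean h a' b' \<le> root k (\<Prod>j<k. c j)"
      using tendsto_le[of "at_right (0::real)"] trivial_limit_at_right_real by blast
    moreover have "(\<Prod>j = n + 1 - k..n. sing_val j L) = (\<Prod>j<k. c j)"
      by (rule prod_sing_val_eigen[OF c c0 k(2)])
    ultimately show ?thesis unfolding sv \<open>op_mean h A B = L\<close> by simp
  qed
qed

end

theorem proposition3p7:
  fixes h :: "real \<Rightarrow> real" and n k :: nat and A B :: "complex mat"
  assumes "representing_function h"
    and "\<exists>\<nu> :: real measure. prob_space \<nu> \<and> sets \<nu> = sets (restrict_space borel {0..1}) \<and>
           (\<forall>x\<ge>0. h x = (\<integral>\<alpha>. rpow x \<alpha> \<partial>\<nu>))"
    and "psd n A" and "psd n B" and "k \<in> {1..n}"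
  shows "root k (\<Prod>j = n + 1 - k..n. sing_val j (op_mean h A B))
       \<ge> scalar_mean h (root k (\<Prod>j = n + 1 - k..n. sing_val j A))
                        (root k (\<Prod>j = n + 1 - k..n. sing_val j B))"
proof -
  obtain \<nu> :: "real measure" where \<nu>: "prob_space \<nu>" "sets \<nu> = sets (restrict_space borel {0..1})"
    "\<And>x. 0 \<le> x \<Longrightarrow> h x = (\<integral>\<alpha>. rpow x \<alpha> \<partial>\<nu>)"
    using assms(2) by blast
  then interpret power_average \<nu> h
    by (intro power_average.intro power_average_axioms.intro)
  show ?thesis using smallest_op_mean_ge[OF assms(3,4)] assms(5) by simp
qed

end
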